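(* For a polynomial $p\in\mathbb{C}[z,w]$ let $\mathcal{Q}_p=H^2(\triangle_H)\ominus pH^2(\triangle_H)$. The following hold, with $m\in\mathbb{Z}_+$. (i) If $p(z,w)=z^qw^n$ with $q,n\in\mathbb{Z}_+$, then $\dim(\mathcal{Q}_p\cap\mathfrak{F}_m)=m+1$ if $m<2q+n$, and $\dim(\mathcal{Q}_p\cap\mathfrak{F}_m)=2q+n$ if $m\ge2q+n$. (ii) Let $p(z,w)=\sum_{i+j\ge1}a_{i,j}z^iw^j$ be a nonzero polynomial in which no two summands (with nonzero coefficient) have the same Hartogs degree. Then there exists $m_0\in\mathbb{N}$ such that for all $m\ge m_0$, $$\dim(\mathcal{Q}_p\cap\mathfrak{F}_m)=\min\{i+j:a_{i,j}\ne0\}+\min\{i:a_{i,j}\neq0\}.$$ (iii) Let $t\in\mathbb{Z}_+$, $b_k\in\mathbb{C}\setminus\{0\}$ for $0\le k\le t$, and let $p(z,w)=\sum_{k=0}^tb_kz^{q_k}w^{n_k}$ be a polynomial whose monomials $z^{q_k}w^{n_k}$ are distinct and all have the same Hartogs degree, with $q_k\le q_{k+1}$ for $0\le k\le t-1$. Then $\dim(\mathcal{Q}_p\cap\mathfrak{F}_m)=m+1$ if $m<2q_0+n_0$, and $\dim(\mathcal{Q}_p\cap\mathfrak{F}_m)=2q_0+n_0$ if $m\ge q_t+q_0+n_0$.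
   Context: The Hartogs triangle is $\triangle_H=\{(z,w)\in\mathbb{C}^2: |z|<|w|<1\}$. The Hardy space $H^2(\triangle_H)$ is the Hilbert space of holomorphic $f$ on $\triangle_H$ with $\|f\|^2=\sup_{s,t\in(0,1)}\frac{1}{4\pi^2}\int_0^{2\pi}\int_0^{2\pi}|f(ste^{i\theta},te^{i\gamma})|^2\,st^2\,d\theta\,d\gamma<\infty$; the functions $\frac1w(\frac zw)^iw^j$, $i,j\ge0$, form an orthonormal basis. For $m\in\mathbb{Z}_+$, $\mathfrak{F}_m$ is the span of $\frac1w(\frac zw)^{m-j}w^j$, $0\le j\le m$. The Hartogs degree of a monomial $z^iw^j$ ($i,j\ge0$) is $2i+j+1$. $\mathcal{Q}_p$ is the orthogonal complement in $H^2(\triangle_H)$ of $\{pg:g\in H^2(\triangle_H)\}$. *)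

theory Defs
  imports "HOL-Complex_Analysis.Complex_Analysis" "HOL-Library.Function_Algebras"
    "HOL-Computational_Algebra.Polynomial"
begin

definition hartogs_triangle :: "(complex \<times> complex) set" where
  "hartogs_triangle = {(z, w). cmod z < cmod w \<and> cmod w < 1}"

text \<open>Holomorphy in two variables, on an open set: the real Frechet derivative exists
  and is complex linear.\<close>

definition holomorphic2_on :: "(complex \<times> complex \<Rightarrow> complex) \<Rightarrow> (complex \<times> complex) set \<Rightarrow> bool" where
  "holomorphic2_on f S \<longleftrightarrow>
     (\<forall>x\<in>S. \<exists>a b. (f has_derivative (\<lambda>(h, k). a * h + b * k)) (at x))"

definition torus_mean :: "(complex \<times> complex \<Rightarrow> complex) \<Rightarrow> real \<Rightarrow> real \<Rightarrow> real" where
  "torus_mean f s t = 1 / (4 * pi\<^sup>2) *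
     integral {0..2 * pi} (\<lambda>\<gamma>. integral {0..2 * pi} (\<lambda>\<theta>.
       (cmod (f (of_real (s * t) * cis \<theta>, of_real t * cis \<gamma>)))\<^sup>2 * (s * t\<^sup>2)))"

text \<open>A function on the Hartogs triangle is represented by its extension by zero to the whole
  of \<open>\<complex> \<times> \<complex>\<close>, so that equal elements of the Hardy space are equal HOL functions.\<close>

definition hardy_space :: "(complex \<times> complex \<Rightarrow> complex) set" where
  "hardy_space = {f. holomorphic2_on f hartogs_triangle \<and> (\<forall>x. x \<notin> hartogs_triangle \<longrightarrow> f x = 0) \<and>
     bdd_above ((\<lambda>(s, t). torus_mean f s t) ` ({0<..<1} \<times> {0<..<1}))}"

definition hardy_norm_sq :: "(complex \<times> complex \<Rightarrow> complex) \<Rightarrow> real" where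
  "hardy_norm_sq f = (SUP (s, t) \<in> {0<..<1} \<times> {0<..<1}. torus_mean f s t)"

definition fscale :: "complex \<Rightarrow> (complex \<times> complex \<Rightarrow> complex) \<Rightarrow> complex \<times> complex \<Rightarrow> complex" where
  "fscale c f = (\<lambda>x. c * f x)"

interpretation cfun: vector_space fscale
  by standard (auto simp: fscale_def fun_eq_iff algebra_simps)

text \<open>The inner product of the Hilbert space, recovered from its norm by polarization
  (linear in the first argument).\<close>

definition hardy_inner ::
  "(complex \<times> complex \<Rightarrow> complex) \<Rightarrow> (complex \<times> complex \<Rightarrow> complex) \<Rightarrow> complex" where
  "hardy_inner f g = 1 / 4 *
     (of_real (hardy_norm_sq (f + g)) - of_real (hardy_norm_sq (f - g))
      + \<i> * of_real (hardy_norm_sq (f + fscale \<i> g)) - \<i> * of_real (hardy_norm_sq (f - fscale \<i> g)))"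

definition hardy_basis :: "nat \<Rightarrow> nat \<Rightarrow> complex \<times> complex \<Rightarrow> complex" where
  "hardy_basis i j = (\<lambda>(z, w). if (z, w) \<in> hartogs_triangle then 1 / w * (z / w) ^ i * w ^ j else 0)"

definition F_space :: "nat \<Rightarrow> (complex \<times> complex \<Rightarrow> complex) set" where
  "F_space m = cfun.span {hardy_basis (m - j) j | j. j \<le> m}"

text \<open>\<open>\<complex>[z, w]\<close> is \<open>\<complex>[w][z]\<close>: the coefficient of \<open>z\<^sup>i w\<^sup>j\<close> in \<open>p\<close> is
  \<open>coeff (coeff p i) j\<close>.\<close>

definition coeff2 :: "complex poly poly \<Rightarrow> nat \<Rightarrow> nat \<Rightarrow> complex" where
  "coeff2 p i j = coeff (coeff p i) j"

definition monom2 :: "complex \<Rightarrow> nat \<Rightarrow> nat \<Rightarrow> complex poly poly" where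
  "monom2 c i j = monom (monom c j) i"

definition eval2 :: "complex poly poly \<Rightarrow> complex \<times> complex \<Rightarrow> complex" where
  "eval2 p = (\<lambda>(z, w). poly (poly p [:z:]) w)"

lemma coeff2_monom2: "coeff2 (monom2 c i j) i' j' = (if i = i' \<and> j = j' then c else 0)"
  by (simp add: coeff2_def monom2_def)

lemma eval2_monom2: "eval2 (monom2 c i j) (z, w) = c * z ^ i * w ^ j"
  by (simp add: eval2_def monom2_def poly_monom poly_power)

lemma eval2_add: "eval2 (p + q) x = eval2 p x + eval2 q x"
  by (simp add: eval2_def case_prod_beta)

definition hartogs_degree :: "nat \<Rightarrow> nat \<Rightarrow> nat" where
  "hartogs_degree i j = 2 * i + j + 1"

definition Q_space :: "complex poly poly \<Rightarrow> (complex \<times> complex \<Rightarrow> complex) set" where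
  "Q_space p = {f \<in> hardy_space. \<forall>h \<in> {eval2 p * g | g. g \<in> hardy_space}. hardy_inner f h = 0}"

end

theory Submission
  imports Defs
begin

text \<open>The change of variables \<open>u = z / w\<close> turns the Hartogs triangle into the disc times the
punctured disc, and the factor \<open>w\<close> in \<open>G(u, w) = w f(u w, w)\<close> absorbs the weight: the mean of
\<open>f\<close> over the torus with radii \<open>s t\<close> and \<open>t\<close> is \<open>s\<close> times the average of \<open>\<bar>G\<bar>\<^sup>2\<close> over
\<open>\<bar>u\<bar> = s\<close>, \<open>\<bar>w\<bar> = t\<close>, and the basis function with indices \<open>i, j\<close> becomes \<open>u\<^sup>i w\<^sup>j\<close>.

The norm is a supremum over radii, so the polarized inner product can only be computed once this
supremum is known to be a limit. By lemma \<open>torus_mean_mono\<close> the means increase in each radius,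
hence the norm is their limit as both radii tend to 1. Monotonicity is proved without
power series: to compare two radii, \<open>G\<close> rescaled by a complex variable is paired
with the conjugate of \<open>G\<close> at the smaller radius. The pairing is holomorphic in that variable,
its singularity at the origin is removable because the means are bounded, and the maximum modulus
principle applies to it.

For a finite combination \<open>f\<close> of basis functions and any \<open>h\<close> in the Hardy space, Cauchy's theorem
then shows that the inner product of \<open>f\<close> with \<open>h\<close> only involves the Laurent coefficients of
\<open>h\<close> (lemma \<open>hardy_inner_homogeneous\<close>), and those with a negative index vanish. Multiplication by
\<open>z\<^sup>k w\<^sup>l\<close> shifts the index \<open>(i, j)\<close> to \<open>(i + k, j + k + l)\<close>, raising the total degree by
\<open>2 k + l\<close>, one less than the Hartogs degree. So \<open>\<Sum>\<^sub>a c\<^sub>a e\<^bsub>a, m - a\<^esub>\<close> lies in \<open>Q\<^sub>p\<close> exactly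
when, for all \<open>i, j\<close>, the sum of \<open>cnj p\<^bsub>k,l\<^esub> c\<^bsub>i + k\<^esub>\<close> over the monomials with \<open>i + j + 2 k + l = m\<close>
vanishes (lemma \<open>homogeneous_in_Q_space_iff\<close>).

The theorem is now linear algebra. These systems are triangular with nonzero pivots, and their
solution space has dimension \<open>m + 1\<close> minus the number of pivots (lemma \<open>dim_triangular_system\<close>).
If all monomials have \<open>2 k + l = d\<close>, there is one equation for each \<open>i \<le> m - d\<close>, with pivot at
the largest exponent of \<open>z\<close>, so the dimension is \<open>min (m + 1) d\<close>; this covers a single
monomial as well. If no two monomials share a Hartogs degree, each equation has at most one term and
kills one coefficient; the surviving indices \<open>(a, m - a)\<close> are those outside the union of the
quadrants with corners \<open>(k, k + l)\<close>, and on a remote antidiagonal only the extreme values of \<open>k\<close>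
and of \<open>k + l\<close> matter.\<close>

section \<open>Integrals over circles\<close>

abbreviation punctured_disc :: "complex set" where
  "punctured_disc \<equiv> ball 0 1 - {0}"

lemma integral_circle_rotate:
  fixes \<phi> :: "complex \<Rightarrow> 'a::banach"
  assumes cont: "continuous_on (sphere 0 r) \<phi>" and r: "0 \<le> r" and \<alpha>: "0 \<le> \<alpha>" "\<alpha> \<le> 2 * pi"
  shows "integral {0..2*pi} (\<lambda>\<theta>. \<phi> (of_real r * cis (\<theta> + \<alpha>)))
       = integral {0..2*pi} (\<lambda>\<theta>. \<phi> (of_real r * cis \<theta>))"
proof -
  define f where "f = (\<lambda>\<theta>. \<phi> (of_real r * cis \<theta>))"
  have cf: "continuous_on S f" for S
    unfolding f_def using r
    by (intro continuous_on_compose2[OF cont] continuous_intros) (auto simp: norm_mult)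
  have int: "f integrable_on {a..b}" for a b
    by (intro integrable_continuous_real cf)
  have per: "f (x + 2 * pi) = f x" for x
    by (simp add: f_def cis_mult[symmetric])
  have "integral {0..2*pi} (\<lambda>\<theta>. f (\<theta> + \<alpha>)) = integral {\<alpha>..2*pi + \<alpha>} f"
    using integral_shift_real_ivl[of \<alpha> \<alpha> "2*pi+\<alpha>" f] by simp
  also have "\<dots> = integral {\<alpha>..2*pi} f + integral {2*pi..2*pi+\<alpha>} f"
    using \<alpha> by (intro Henstock_Kurzweil_Integration.integral_combine[symmetric] int) auto
  also have "integral {2*pi..2*pi+\<alpha>} f = integral {0..\<alpha>} f"
    using integral_shift_real_ivl[of "2*pi" "2*pi" "2*pi+\<alpha>" f] by (simp add: per)
  also have "integral {\<alpha>..2*pi} f + integral {0..\<alpha>} f = integral {0..2*pi} f"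
    using \<alpha> Henstock_Kurzweil_Integration.integral_combine[of 0 \<alpha> "2*pi" f] int by (simp add: add.commute)
  finally show ?thesis by (simp add: f_def)
qed

lemma contour_integral_circlepath_cis:
  "contour_integral (circlepath 0 r) f
     = integral {0..2*pi} (\<lambda>\<theta>. f (of_real r * cis \<theta>) * (of_real r * cis \<theta>) * \<i>)"
  unfolding circlepath_def
  by (subst contour_integral_part_circlepath_eq) (simp_all add: mult_ac)

text \<open>The integral is, up to the factor \<open>\<i>\<close>, the contour integral of \<open>F z / z\<close>, which does not change
when the circle is deformed inside the punctured disc.\<close>
lemma integral_circle_radius_independent:
  assumes F: "F holomorphic_on punctured_disc" and r: "0 < r1" "r1 < 1" "0 < r2" "r2 < 1"
  shows "integral {0..2*pi} (\<lambda>\<theta>. F (of_real r1 * cis \<theta>))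
       = integral {0..2*pi} (\<lambda>\<theta>. F (of_real r2 * cis \<theta>))"
proof -
  have *: "integral {0..2*pi} (\<lambda>\<theta>. F (of_real r * cis \<theta>))
      = contour_integral (circlepath 0 r) (\<lambda>z. F z / z) / \<i>" if "0 < r" for r :: real
  proof -
    have "contour_integral (circlepath 0 r) (\<lambda>z. F z / z)
      = integral {0..2*pi} (\<lambda>\<theta>. F (of_real r * cis \<theta>) * \<i>)"
      unfolding contour_integral_circlepath_cis using that by simp
    then have "contour_integral (circlepath 0 r) (\<lambda>z. F z / z)
      = integral {0..2*pi} (\<lambda>\<theta>. F (of_real r * cis \<theta>)) * \<i>"
      by simp
    then show ?thesis by (simp only: nonzero_mult_div_cancel_right complex_i_not_zero not_False_eq_True)
  qed
  have hol: "(\<lambda>z. F z / z) holomorphic_on punctured_disc"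
    by (intro holomorphic_intros F) auto
  have "contour_integral (circlepath 0 r2) (\<lambda>z. F z / z) = contour_integral (circlepath 0 r1) (\<lambda>z. F z / z)"
    if "0 < r1" "r1 \<le> r2" "r2 < 1" for r1 r2
    by (rule contour_integral_circlepath_eq(3)[of "ball 0 1"]) (use that hol in auto)
  from this[of r1 r2] this[of r2 r1] r show ?thesis
    by (cases "r1 \<le> r2") (auto simp: *)
qed

lemma integral_circle_mean_value:
  fixes F :: "complex \<Rightarrow> complex"
  assumes F: "F holomorphic_on ball 0 1" and r: "0 < r" "r < 1"
  shows "integral {0..2*pi} (\<lambda>\<theta>. F (of_real r * cis \<theta>)) = 2 * pi * F 0"
proof -
  have "((\<lambda>u. F u/(u-0)) has_contour_integral (2 * of_real pi * \<i> * F 0)) (circlepath 0 r)"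
    by (rule Cauchy_integral_circlepath_simple) (use r in \<open>auto intro: holomorphic_on_subset[OF F]\<close>)
  then have "2 * of_real pi * \<i> * F 0 = integral {0..2*pi} (\<lambda>\<theta>. F (of_real r * cis \<theta>) * \<i>)"
    using r by (auto dest!: contour_integral_unique simp: contour_integral_circlepath_cis)
  then have "\<i> * (2 * pi * F 0) = \<i> * integral {0..2*pi} (\<lambda>\<theta>. F (of_real r * cis \<theta>))"
    by (simp add: integral_mult_left mult_ac)
  then show ?thesis by simp
qed

text \<open>Differentiation under the integral needs a jointly continuous derivative, whereas only joint
continuity of \<open>\<Phi>\<close> is assumed. Cauchy's formula for the derivative, as an integral over a
fixed small circle, supplies it.\<close>
lemma holomorphic_on_parametric_integral:
  fixes \<Phi> :: "complex \<Rightarrow> 'b::euclidean_space \<Rightarrow> complex"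
  assumes S: "open S"
    and cont: "continuous_on (S \<times> cbox a b) (\<lambda>(\<zeta>, x). \<Phi> \<zeta> x)"
    and hol: "\<And>x. x \<in> cbox a b \<Longrightarrow> (\<lambda>\<zeta>. \<Phi> \<zeta> x) holomorphic_on S"
  shows "(\<lambda>\<zeta>. integral (cbox a b) (\<Phi> \<zeta>)) holomorphic_on S"
proof -
  have "(\<lambda>\<zeta>. integral (cbox a b) (\<Phi> \<zeta>)) field_differentiable at z0" if z0: "z0 \<in> S" for z0
  proof -
    obtain d where d: "d > 0" "cball z0 d \<subseteq> S"
      using S z0 open_contains_cball by blast
    define fx where "fx = (\<lambda>\<zeta> x. 1 / (2 * of_real pi * \<i>) *
      contour_integral (circlepath z0 d) (\<lambda>u. \<Phi> u x / (u - \<zeta>)^2))"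
    have fx_eq: "fx \<zeta> x = 1 / (2 * of_real pi * \<i>) *
       integral (cbox 0 (2*pi)) (\<lambda>t. \<Phi> (z0 + d * cis t) x / (z0 + d * cis t - \<zeta>)^2 * d * \<i> * cis t)" for \<zeta> x
      unfolding fx_def circlepath_def by (subst contour_integral_part_circlepath_eq) auto
    have "(\<lambda>\<zeta>. integral (cbox a b) (\<Phi> \<zeta>)) holomorphic_on ball z0 d"
    proof (rule leibniz_rule_holomorphic[where fx = fx])
      fix \<zeta> x assume *: "\<zeta> \<in> ball z0 d" "x \<in> cbox a b"
      show "((\<lambda>\<zeta>. \<Phi> \<zeta> x) has_field_derivative fx \<zeta> x) (at \<zeta> within ball z0 d)"
        unfolding fx_def
        by (rule has_field_derivative_at_within, rule Cauchy_derivative_integral_circlepath(2))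
          (use * holomorphic_on_subset[OF hol[of x], of "cball z0 d"] holomorphic_on_subset[OF hol[of x], of "ball z0 d"]
            d ball_subset_cball[of z0 d] in \<open>auto intro!: holomorphic_on_imp_continuous_on simp del: ball_subset_cball\<close>)
    next
      fix \<zeta> assume "\<zeta> \<in> ball z0 d"
      then have "\<zeta> \<in> S" using d by auto
      then show "\<Phi> \<zeta> integrable_on cbox a b"
        by (intro integrable_continuous continuous_on_compose2[OF cont, of _ "\<lambda>x. (\<zeta>, x)", simplified])
          (auto intro!: continuous_intros)
    next
      have ne: "z0 + d * cis t - \<zeta> \<noteq> 0" if "\<zeta> \<in> ball z0 d" for t \<zeta>
      proof
        assume "z0 + d * cis t - \<zeta> = 0"
        then have "\<zeta> - z0 = d * cis t" by (simp add: algebra_simps)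
        then have "dist z0 \<zeta> = d" using d by (simp add: dist_norm norm_minus_commute norm_mult)
        then show False using that by simp
      qed
      show "continuous_on (ball z0 d \<times> cbox a b) (\<lambda>(\<zeta>, x). fx \<zeta> x)"
        unfolding fx_eq case_prod_unfold
      proof (rule continuous_on_mult_left, rule integral_continuous_on_param)
        have "continuous_on ((ball z0 d \<times> cbox a b) \<times> cbox 0 (2 * pi))
          (\<lambda>p. \<Phi> (z0 + d * cis (snd p)) (snd (fst p)))"
          by (rule continuous_on_compose2[OF cont, of _ "\<lambda>p. (z0 + d * cis (snd p), snd (fst p))", simplified])
            (use d in \<open>auto intro!: continuous_intros simp: dist_norm norm_mult\<close>)
        then show "continuous_on ((ball z0 d \<times> cbox a b) \<times> cbox 0 (2 * pi))
          (\<lambda>(p, t). \<Phi> (z0 + d * cis t) (snd p) / (z0 + d * cis t - fst p)\<^sup>2 * d * \<i> * cis t)"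
          unfolding case_prod_unfold by (intro continuous_intros) (use ne in auto)
      qed
    qed auto
    then show ?thesis using d holomorphic_on_imp_differentiable_at[of _ "ball z0 d" z0] by auto
  qed
  then show ?thesis by (auto simp: holomorphic_on_def intro: field_differentiable_at_within)
qed

text \<open>Put \<open>H \<zeta> = \<integral> \<Phi> \<zeta> x cnj (\<Phi> r1 x) dx\<close>. Then \<open>H r1 = D r1\<close>, while the inequality
\<open>\<bar>a b\<bar> \<le> (\<bar>a\<bar>\<^sup>2 + \<bar>b\<bar>\<^sup>2) / 2\<close> gives \<open>\<bar>H \<zeta>\<bar> \<le> (D \<bar>\<zeta>\<bar> + D r1) / 2\<close>. The bound on \<open>D\<close> near the origin makes
\<open>H\<close> extend over \<open>0\<close>, and the maximum principle on the disc of radius \<open>r2\<close> yields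
\<open>D r1 \<le> (D r2 + D r1) / 2\<close>.\<close>
lemma square_integral_mono_radius:
  fixes \<Phi> :: "complex \<Rightarrow> 'b::euclidean_space \<Rightarrow> complex" and a b :: 'b
  defines "D \<equiv> (\<lambda>\<zeta>. integral (cbox a b) (\<lambda>x. (cmod (\<Phi> \<zeta> x))\<^sup>2))"
  assumes cont: "continuous_on (punctured_disc \<times> cbox a b) (\<lambda>(\<zeta>, x). \<Phi> \<zeta> x)"
    and hol: "\<And>x. x \<in> cbox a b \<Longrightarrow> (\<lambda>\<zeta>. \<Phi> \<zeta> x) holomorphic_on punctured_disc"
    and rot: "\<And>\<zeta>. \<zeta> \<in> punctured_disc \<Longrightarrow> D \<zeta> = D (of_real (cmod \<zeta>))"
    and bdd: "\<And>r. 0 < r \<Longrightarrow> r < 1/2 \<Longrightarrow> D (of_real r) \<le> C"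
    and r: "0 < r1" "r1 \<le> r2" "r2 < 1"
  shows "D (of_real r1) \<le> D (of_real r2)"
proof -
  define H where "H = (\<lambda>\<zeta>. integral (cbox a b) (\<lambda>x. \<Phi> \<zeta> x * cnj (\<Phi> (of_real r1) x)))"
  have r1: "of_real r1 \<in> punctured_disc" using r by auto
  have contx: "continuous_on (cbox a b) (\<Phi> \<zeta>)" if "\<zeta> \<in> punctured_disc" for \<zeta>
    by (rule continuous_on_compose2[OF cont, of _ "\<lambda>x. (\<zeta>, x)", simplified])
      (use that in \<open>auto intro!: continuous_intros\<close>)
  have holH: "H holomorphic_on punctured_disc"
    unfolding H_def
  proof (rule holomorphic_on_parametric_integral)
    have "continuous_on (punctured_disc \<times> cbox a b) (\<lambda>p. \<Phi> (of_real r1) (snd p))"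
      by (rule continuous_on_compose2[OF contx[OF r1]]) (auto intro!: continuous_intros)
    then show "continuous_on (punctured_disc \<times> cbox a b) (\<lambda>(\<zeta>, x). \<Phi> \<zeta> x * cnj (\<Phi> (of_real r1) x))"
      using cont unfolding case_prod_unfold by (intro continuous_intros)
  qed (auto intro!: holomorphic_intros hol)
  have Hle: "cmod (H \<zeta>) \<le> (D (of_real (cmod \<zeta>)) + D (of_real r1)) / 2" if z: "\<zeta> \<in> punctured_disc" for \<zeta>
  proof -
    have i: "(\<lambda>x. (cmod (\<Phi> \<zeta> x))\<^sup>2) integrable_on cbox a b" "(\<lambda>x. (cmod (\<Phi> r1 x))\<^sup>2) integrable_on cbox a b"
      by (intro integrable_continuous continuous_intros contx z r1)+
    have "cmod (H \<zeta>) \<le> integral (cbox a b) (\<lambda>x. ((cmod (\<Phi> \<zeta> x))\<^sup>2 + (cmod (\<Phi> r1 x))\<^sup>2) / 2)"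
      unfolding H_def
    proof (rule integral_norm_bound_integral)
      fix x
      have "0 \<le> (cmod (\<Phi> \<zeta> x) - cmod (\<Phi> r1 x))\<^sup>2" by simp
      then show "cmod (\<Phi> \<zeta> x * cnj (\<Phi> r1 x)) \<le> ((cmod (\<Phi> \<zeta> x))\<^sup>2 + (cmod (\<Phi> r1 x))\<^sup>2) / 2"
        by (simp add: norm_mult power2_eq_square algebra_simps)
    qed (intro integrable_continuous continuous_intros contx z r1; simp)+
    also have "\<dots> = (D \<zeta> + D r1) / 2"
      unfolding D_def using i by (simp add: Henstock_Kurzweil_Integration.integral_add)
    finally show ?thesis using rot[OF z] by simp
  qed
  have "eventually (\<lambda>z. cmod (H z) \<le> (C + D r1) / 2) (at 0)"
    unfolding eventually_at
  proof (intro exI[of _ "1/2"] conjI ballI impI)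
    fix \<zeta> :: complex assume "\<zeta> \<noteq> 0 \<and> dist \<zeta> 0 < 1 / 2"
    then show "cmod (H \<zeta>) \<le> (C + D r1) / 2"
      using Hle[of \<zeta>] bdd[of "cmod \<zeta>"] by auto
  qed auto
  then have "\<exists>B. eventually (\<lambda>z. cmod (H z) \<le> B) (at 0)" by blast
  then obtain K where K: "K holomorphic_on ball 0 1" "\<And>z. z \<in> punctured_disc \<Longrightarrow> K z = H z"
    using holomorphic_on_extend_bounded[OF holH] by fastforce
  have "cmod (K r1) \<le> (D r2 + D r1) / 2"
  proof (rule maximum_modulus_frontier[where f = K and S = "cball 0 r2"])
    show "K holomorphic_on interior (cball 0 r2)"
      by (rule holomorphic_on_subset[OF K(1)]) (use r in auto)
    show "continuous_on (closure (cball 0 r2)) K"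
      by (rule holomorphic_on_imp_continuous_on, rule holomorphic_on_subset[OF K(1)]) (use r in auto)
    fix z :: complex assume "z \<in> frontier (cball 0 r2)"
    then have z: "cmod z = r2" using r by auto
    with r have zp: "z \<in> punctured_disc" by auto
    then show "cmod (K z) \<le> (D r2 + D r1) / 2" using K(2)[OF zp] Hle[OF zp] z by simp
  qed (use r in auto)
  moreover have "K r1 = of_real (D r1)"
  proof -
    have "K r1 = integral (cbox a b) (\<lambda>x. of_real ((cmod (\<Phi> r1 x))\<^sup>2))"
      unfolding K(2)[OF r1] H_def by (simp only: complex_norm_square)
    also have "\<dots> = of_real (D r1)"
      unfolding D_def using contx[OF r1]
      by (intro integral_unique has_integral_of_real integrable_integral integrable_continuous continuous_intros)
    finally show ?thesis .
  qed
  moreover have "D r1 \<ge> 0" unfolding D_def by (intro integral_nonneg integrable_continuous continuous_intros contx r1) auto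
  ultimately show ?thesis by simp
qed

section \<open>Fibre coordinates and torus averages\<close>

lemma holomorphic2_on_compose:
  assumes f: "holomorphic2_on f S" and T: "open T"
    and a: "a holomorphic_on T" and b: "b holomorphic_on T"
    and mem: "\<And>\<zeta>. \<zeta> \<in> T \<Longrightarrow> (a \<zeta>, b \<zeta>) \<in> S"
  shows "(\<lambda>\<zeta>. f (a \<zeta>, b \<zeta>)) holomorphic_on T"
proof -
  have "(\<lambda>\<zeta>. f (a \<zeta>, b \<zeta>)) field_differentiable at \<zeta>" if z: "\<zeta> \<in> T" for \<zeta>
  proof -
    obtain \<alpha> \<beta> where d: "(f has_derivative (\<lambda>(h, k). \<alpha> * h + \<beta> * k)) (at (a \<zeta>, b \<zeta>))"
      using f mem[OF z] by (auto simp: holomorphic2_on_def)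
    obtain a' b' where "(a has_field_derivative a') (at \<zeta>)" "(b has_field_derivative b') (at \<zeta>)"
      using a b T z by (meson holomorphic_on_imp_differentiable_at field_differentiable_def)
    then have "((\<lambda>\<zeta>. (a \<zeta>, b \<zeta>)) has_derivative (\<lambda>h. (a' * h, b' * h))) (at \<zeta>)"
      by (auto simp: has_field_derivative_def intro: has_derivative_Pair)
    from has_derivative_compose[OF this d]
    have "((\<lambda>\<zeta>. f (a \<zeta>, b \<zeta>)) has_derivative (\<lambda>h. (\<alpha> * a' + \<beta> * b') * h)) (at \<zeta>)"
      by (simp add: algebra_simps)
    then show ?thesis by (auto simp: field_differentiable_def has_field_derivative_def)
  qed
  then show ?thesis by (auto simp: holomorphic_on_def intro: field_differentiable_at_within)
qed

lemma holomorphic2_on_imp_continuous_on: "holomorphic2_on f S \<Longrightarrow> continuous_on S f"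
  unfolding holomorphic2_on_def
  by (meson continuous_at_imp_continuous_on has_derivative_continuous)

text \<open>The substitution \<open>z = u w\<close>; the factor \<open>w\<close> makes the basis functions into the
monomials \<open>u\<^sup>i w\<^sup>j\<close> and removes \<open>t\<^sup>2\<close> from the weight of \<open>torus_mean\<close>.\<close>
definition fibre_pullback :: "(complex \<times> complex \<Rightarrow> complex) \<Rightarrow> complex \<Rightarrow> complex \<Rightarrow> complex" where
  "fibre_pullback f u w = w * f (u * w, w)"

lemma mem_hartogs_triangle_fibre:
  assumes "u \<in> ball 0 1" "w \<in> punctured_disc"
  shows "(u * w, w) \<in> hartogs_triangle"
  using assms mult_strict_right_mono[of "cmod u" 1 "cmod w"]
  by (auto simp: hartogs_triangle_def norm_mult)

lemma
  assumes f: "holomorphic2_on f hartogs_triangle"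
  shows continuous_on_fibre_pullback: "continuous_on (ball 0 1 \<times> punctured_disc) (\<lambda>(u, w). fibre_pullback f u w)"
    and fibre_pullback_holomorphic_1:
      "w \<in> punctured_disc \<Longrightarrow> (\<lambda>u. fibre_pullback f u w) holomorphic_on ball 0 1"
    and fibre_pullback_holomorphic_2:
      "u \<in> ball 0 1 \<Longrightarrow> (\<lambda>w. fibre_pullback f u w) holomorphic_on punctured_disc"
proof -
  have "continuous_on (ball 0 1 \<times> punctured_disc) (\<lambda>p. f (fst p * snd p, snd p))"
    by (rule continuous_on_compose2[OF holomorphic2_on_imp_continuous_on[OF f]])
      (auto intro!: continuous_intros mem_hartogs_triangle_fibre)
  then show "continuous_on (ball 0 1 \<times> punctured_disc) (\<lambda>(u, w). fibre_pullback f u w)"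
    unfolding fibre_pullback_def case_prod_unfold by (intro continuous_intros)
next
  show "(\<lambda>u. fibre_pullback f u w) holomorphic_on ball 0 1" if "w \<in> punctured_disc"
    unfolding fibre_pullback_def using that mem_hartogs_triangle_fibre
    by (intro holomorphic_intros holomorphic2_on_compose[OF f]) auto
next
  show "(\<lambda>w. fibre_pullback f u w) holomorphic_on punctured_disc" if "u \<in> ball 0 1"
    unfolding fibre_pullback_def using that mem_hartogs_triangle_fibre
    by (intro holomorphic_intros holomorphic2_on_compose[OF f]) auto
qed

abbreviation torus_box :: "(real \<times> real) set" where
  "torus_box \<equiv> cbox (0, 0) (2 * pi, 2 * pi)"

text \<open>The double integral is taken over a box in the plane, so that one parametric integral covers both
angles; the first coordinate is the angle of \<open>w\<close>, as in \<open>torus_mean\<close>.\<close>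
definition torus_avg :: "(complex \<Rightarrow> complex \<Rightarrow> 'a::banach) \<Rightarrow> real \<Rightarrow> real \<Rightarrow> 'a" where
  "torus_avg F s t = (1 / (4 * pi\<^sup>2)) *\<^sub>R
     integral torus_box (\<lambda>(\<gamma>, \<theta>). F (of_real s * cis \<theta>) (of_real t * cis \<gamma>))"

abbreviation torus_cont :: "(complex \<Rightarrow> complex \<Rightarrow> 'a::topological_space) \<Rightarrow> bool" where
  "torus_cont F \<equiv> continuous_on (punctured_disc \<times> punctured_disc) (\<lambda>(u, w). F u w)"

lemma torus_cont_fibre_pullback:
  "holomorphic2_on f hartogs_triangle \<Longrightarrow> torus_cont (fibre_pullback f)"
  by (rule continuous_on_subset[OF continuous_on_fibre_pullback]) auto

lemma torus_cont_box:
  assumes "torus_cont F" "\<zeta> \<in> punctured_disc" "\<omega> \<in> punctured_disc"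
  shows "continuous_on S (\<lambda>(\<gamma>, \<theta>). F (\<zeta> * cis \<theta>) (\<omega> * cis \<gamma>))"
  unfolding case_prod_unfold
  by (rule continuous_on_compose2[OF assms(1), of _ "\<lambda>p. (\<zeta> * cis (snd p), \<omega> * cis (fst p))", simplified])
    (use assms(2,3) in \<open>auto intro!: continuous_intros simp: norm_mult\<close>)

lemma torus_box_integral_iterated:
  fixes F :: "complex \<Rightarrow> complex \<Rightarrow> 'a::banach"
  assumes "torus_cont F" "\<zeta> \<in> punctured_disc" "\<omega> \<in> punctured_disc"
  shows "integral torus_box (\<lambda>(\<gamma>, \<theta>). F (\<zeta> * cis \<theta>) (\<omega> * cis \<gamma>))
       = integral {0..2*pi} (\<lambda>\<gamma>. integral {0..2*pi} (\<lambda>\<theta>. F (\<zeta> * cis \<theta>) (\<omega> * cis \<gamma>)))" (is ?th1)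
    and "integral torus_box (\<lambda>(\<gamma>, \<theta>). F (\<zeta> * cis \<theta>) (\<omega> * cis \<gamma>))
       = integral {0..2*pi} (\<lambda>\<theta>. integral {0..2*pi} (\<lambda>\<gamma>. F (\<zeta> * cis \<theta>) (\<omega> * cis \<gamma>)))" (is ?th2)
proof -
  show ?th1
    using integral_prod_continuous[OF torus_cont_box[OF assms]] by simp
  also have "\<dots> = integral {0..2*pi} (\<lambda>\<theta>. integral {0..2*pi} (\<lambda>\<gamma>. F (\<zeta> * cis \<theta>) (\<omega> * cis \<gamma>)))"
    using integral_swap_continuous[OF torus_cont_box[OF assms]] by simp
  finally show ?th2 .
qed

lemma torus_box_integral_rotate:
  fixes F :: "complex \<Rightarrow> complex \<Rightarrow> 'a::banach"
  assumes F: "torus_cont F" and z: "\<zeta> \<in> punctured_disc" and w: "\<omega> \<in> punctured_disc"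
  shows "integral torus_box (\<lambda>(\<gamma>, \<theta>). F (\<zeta> * cis \<theta>) (\<omega> * cis \<gamma>))
       = integral torus_box (\<lambda>(\<gamma>, \<theta>). F (of_real (cmod \<zeta>) * cis \<theta>) (of_real (cmod \<omega>) * cis \<gamma>))"
proof -
  have polar: "\<exists>\<alpha>. 0 \<le> \<alpha> \<and> \<alpha> \<le> 2 * pi \<and> z = of_real (cmod z) * cis \<alpha>" for z
    by (metis Arg2pi Arg2pi_eq cis_conv_exp less_eq_real_def)
  have rot: "integral {0..2*pi} (\<lambda>\<theta>. \<phi> (z * cis \<theta>)) = integral {0..2*pi} (\<lambda>\<theta>. \<phi> (of_real (cmod z) * cis \<theta>))"
    if "continuous_on (sphere 0 (cmod z)) \<phi>" for \<phi> :: "complex \<Rightarrow> 'a" and z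
  proof -
    obtain \<alpha> where \<alpha>: "0 \<le> \<alpha>" "\<alpha> \<le> 2 * pi" "z = of_real (cmod z) * cis \<alpha>" using polar by blast
    have "z * cis \<theta> = of_real (cmod z) * cis (\<theta> + \<alpha>)" for \<theta>
      by (subst \<alpha>(3)) (simp add: cis_mult mult.assoc add.commute)
    with integral_circle_rotate[OF that _ \<alpha>(1,2)] show ?thesis by simp
  qed
  have z': "of_real (cmod \<zeta>) \<in> punctured_disc" and w': "of_real (cmod \<omega>) \<in> punctured_disc"
    using z w by auto
  have "integral torus_box (\<lambda>(\<gamma>, \<theta>). F (\<zeta> * cis \<theta>) (\<omega> * cis \<gamma>))
     = integral torus_box (\<lambda>(\<gamma>, \<theta>). F (of_real (cmod \<zeta>) * cis \<theta>) (\<omega> * cis \<gamma>))"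
    unfolding torus_box_integral_iterated(1)[OF F z w] torus_box_integral_iterated(1)[OF F z' w]
  proof (rule Henstock_Kurzweil_Integration.integral_cong)
    fix \<gamma> :: real
    have "continuous_on (sphere 0 (cmod \<zeta>)) (\<lambda>u. F u (\<omega> * cis \<gamma>))"
      by (rule continuous_on_compose2[OF F, of _ "\<lambda>u. (u, \<omega> * cis \<gamma>)", simplified])
        (use z w in \<open>auto intro!: continuous_intros simp: norm_mult\<close>)
    from rot[OF this]
    show "integral {0..2*pi} (\<lambda>\<theta>. F (\<zeta> * cis \<theta>) (\<omega> * cis \<gamma>))
      = integral {0..2*pi} (\<lambda>\<theta>. F (of_real (cmod \<zeta>) * cis \<theta>) (\<omega> * cis \<gamma>))" .
  qed
  also have "\<dots> = integral torus_box (\<lambda>(\<gamma>, \<theta>). F (of_real (cmod \<zeta>) * cis \<theta>) (of_real (cmod \<omega>) * cis \<gamma>))"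
    unfolding torus_box_integral_iterated(2)[OF F z' w] torus_box_integral_iterated(2)[OF F z' w']
  proof (rule Henstock_Kurzweil_Integration.integral_cong)
    fix \<theta> :: real
    have "continuous_on (sphere 0 (cmod \<omega>)) (\<lambda>w. F (of_real (cmod \<zeta>) * cis \<theta>) w)"
      by (rule continuous_on_compose2[OF F, of _ "\<lambda>w. (of_real (cmod \<zeta>) * cis \<theta>, w)", simplified])
        (use z w in \<open>auto intro!: continuous_intros simp: norm_mult\<close>)
    from rot[OF this]
    show "integral {0..2*pi} (\<lambda>\<gamma>. F (of_real (cmod \<zeta>) * cis \<theta>) (\<omega> * cis \<gamma>))
      = integral {0..2*pi} (\<lambda>\<gamma>. F (of_real (cmod \<zeta>) * cis \<theta>) (of_real (cmod \<omega>) * cis \<gamma>))" .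
  qed
  finally show ?thesis .
qed

lemma torus_integrable:
  fixes F :: "complex \<Rightarrow> complex \<Rightarrow> 'a::banach"
  assumes "torus_cont F" "0 < s" "s < 1" "0 < t" "t < 1"
  shows "(\<lambda>(\<gamma>, \<theta>). F (of_real s * cis \<theta>) (of_real t * cis \<gamma>)) integrable_on torus_box"
  by (intro integrable_continuous torus_cont_box assms(1)) (use assms in auto)

lemma torus_avg_add:
  fixes F G :: "complex \<Rightarrow> complex \<Rightarrow> 'a::banach"
  assumes "torus_cont F" "torus_cont G" "0 < s" "s < 1" "0 < t" "t < 1"
  shows "torus_avg (\<lambda>u w. F u w + G u w) s t = torus_avg F s t + torus_avg G s t"
  unfolding torus_avg_def
  using Henstock_Kurzweil_Integration.integral_add[OF torus_integrable[OF assms(1,3-6)] torus_integrable[OF assms(2-6)]]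
  by (simp add: case_prod_unfold scaleR_add_right)

lemma torus_avg_sum:
  fixes F :: "'i \<Rightarrow> complex \<Rightarrow> complex \<Rightarrow> 'a::banach"
  assumes "finite I" "\<And>i. i \<in> I \<Longrightarrow> torus_cont (F i)" "0 < s" "s < 1" "0 < t" "t < 1"
  shows "torus_avg (\<lambda>u w. \<Sum>i\<in>I. F i u w) s t = (\<Sum>i\<in>I. torus_avg (F i) s t)"
  unfolding torus_avg_def
  using Henstock_Kurzweil_Integration.integral_sum[OF assms(1) torus_integrable[OF assms(2)]] assms(3-)
  by (simp add: case_prod_unfold scaleR_sum_right)

lemma torus_avg_mult_left:
  fixes c :: "'a::{real_normed_field,banach}"
  shows "torus_avg (\<lambda>u w. c * F u w) s t = c * torus_avg F s t"
  by (simp add: torus_avg_def case_prod_unfold)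

lemma torus_avg_cnj: "torus_avg (\<lambda>u w. cnj (F u w)) s t = cnj (torus_avg F s t)"
  by (simp add: torus_avg_def case_prod_unfold integral_cnj)

lemma torus_avg_const: "torus_avg (\<lambda>u w. c) s t = c"
  by (simp add: torus_avg_def case_prod_unfold content_Pair power2_eq_square)

lemma torus_avg_of_real:
  assumes "torus_cont F" "0 < s" "s < 1" "0 < t" "t < 1"
  shows "torus_avg (\<lambda>u w. complex_of_real (F u w)) s t = of_real (torus_avg F s t)"
  using has_integral_of_real[OF integrable_integral[OF torus_integrable[OF assms]]]
  by (auto simp: torus_avg_def case_prod_unfold scaleR_conv_of_real dest!: integral_unique)

lemma torus_avg_cong:
  assumes "\<And>u w. cmod u = s \<Longrightarrow> cmod w = t \<Longrightarrow> F u w = G u w" "0 < s" "0 < t"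
  shows "torus_avg F s t = torus_avg G s t"
  unfolding torus_avg_def using assms
  by (auto intro!: arg_cong[where f = "\<lambda>x. x /\<^sub>R _"] Henstock_Kurzweil_Integration.integral_cong simp: norm_mult)

lemma torus_avg_mono:
  fixes F G :: "complex \<Rightarrow> complex \<Rightarrow> real"
  assumes "torus_cont F" "torus_cont G" "0 < s" "s < 1" "0 < t" "t < 1"
    and "\<And>u w. cmod u = s \<Longrightarrow> cmod w = t \<Longrightarrow> F u w \<le> G u w"
  shows "torus_avg F s t \<le> torus_avg G s t"
  unfolding torus_avg_def
  by (intro scaleR_left_mono integral_le torus_integrable assms) (use assms in \<open>auto simp: norm_mult\<close>)

lemma norm_torus_avg_le:
  fixes F :: "complex \<Rightarrow> complex \<Rightarrow> complex"
  assumes "torus_cont F" "torus_cont G" "0 < s" "s < 1" "0 < t" "t < 1"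
    and "\<And>u w. cmod u = s \<Longrightarrow> cmod w = t \<Longrightarrow> cmod (F u w) \<le> G u w"
  shows "cmod (torus_avg F s t) \<le> torus_avg G s t"
proof -
  have "cmod (integral torus_box (\<lambda>(\<gamma>, \<theta>). F (of_real s * cis \<theta>) (of_real t * cis \<gamma>)))
    \<le> integral torus_box (\<lambda>(\<gamma>, \<theta>). G (of_real s * cis \<theta>) (of_real t * cis \<gamma>))"
    by (intro integral_norm_bound_integral torus_integrable assms) (use assms in \<open>auto simp: norm_mult\<close>)
  then show ?thesis by (simp add: torus_avg_def divide_right_mono)
qed

text \<open>On the torus \<open>z = u w\<close> has argument \<open>\<theta> + \<gamma>\<close> when \<open>u\<close> has argument \<open>\<theta>\<close>; rotating
the inner circle by \<open>\<gamma>\<close> does not change the integral.\<close>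
lemma torus_mean_eq_torus_avg:
  assumes f: "holomorphic2_on f hartogs_triangle" and st: "0 < s" "s < 1" "0 < t" "t < 1"
  shows "torus_mean f s t = s * torus_avg (\<lambda>u w. (cmod (fibre_pullback f u w))\<^sup>2) s t"
proof -
  have F: "torus_cont (\<lambda>u w. (cmod (fibre_pullback f u w))\<^sup>2)"
    using torus_cont_fibre_pullback[OF f] unfolding case_prod_unfold by (intro continuous_intros)
  have inner: "integral {0..2 * pi} (\<lambda>\<theta>. (cmod (f (of_real (s * t) * cis \<theta>, of_real t * cis \<gamma>)))\<^sup>2 * (s * t\<^sup>2))
    = s * integral {0..2*pi} (\<lambda>\<theta>. (cmod (fibre_pullback f (of_real s * cis \<theta>) (of_real t * cis \<gamma>)))\<^sup>2)"
    if g: "\<gamma> \<in> {0..2*pi}" for \<gamma>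
  proof -
    define \<phi> where "\<phi> = (\<lambda>z. (cmod (f (z, of_real t * cis \<gamma>)))\<^sup>2 * (s * t\<^sup>2))"
    have "continuous_on (sphere 0 (s*t)) (\<lambda>z. f (z, of_real t * cis \<gamma>))"
      by (rule continuous_on_compose2[OF holomorphic2_on_imp_continuous_on[OF f]])
        (use st in \<open>auto intro!: continuous_intros simp: hartogs_triangle_def norm_mult\<close>)
    then have "continuous_on (sphere 0 (s*t)) \<phi>" unfolding \<phi>_def by (intro continuous_intros)
    from integral_circle_rotate[OF this, of \<gamma>]
    have "integral {0..2 * pi} (\<lambda>\<theta>. \<phi> (of_real (s * t) * cis \<theta>))
        = integral {0..2 * pi} (\<lambda>\<theta>. \<phi> (of_real (s * t) * cis (\<theta> + \<gamma>)))"
      using g st by simp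
    also have "\<dots> = integral {0..2 * pi} (\<lambda>\<theta>. s * (cmod (fibre_pullback f (of_real s * cis \<theta>) (of_real t * cis \<gamma>)))\<^sup>2)"
      using st by (simp add: \<phi>_def fibre_pullback_def norm_mult power_mult_distrib cis_mult[symmetric] mult_ac)
    finally show ?thesis by (simp add: \<phi>_def)
  qed
  have "torus_mean f s t = 1 / (4 * pi\<^sup>2) *
    integral {0..2 * pi} (\<lambda>\<gamma>. s * integral {0..2*pi}
       (\<lambda>\<theta>. (cmod (fibre_pullback f (of_real s * cis \<theta>) (of_real t * cis \<gamma>)))\<^sup>2))"
    unfolding torus_mean_def using inner
    by (intro arg_cong[where f = "\<lambda>x. 1 / (4 * pi\<^sup>2) * x"] Henstock_Kurzweil_Integration.integral_cong) 
  also have "\<dots> = s * torus_avg (\<lambda>u w. (cmod (fibre_pullback f u w))\<^sup>2) s t"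
    unfolding torus_avg_def using torus_box_integral_iterated(1)[OF F, of "of_real s" "of_real t"] st by simp
  finally show ?thesis .
qed

section \<open>The norm as a limit of torus means\<close>

text \<open>Both radii are treated by \<open>square_integral_mono_radius\<close>, with the two angles as parameters.
In the \<open>u\<close> direction the pullback is continuous up to \<open>u = 0\<close>, so it is bounded there by compactness;
in the \<open>w\<close> direction the bound comes from the finiteness of the Hardy norm.\<close>
lemma torus_mean_mono:
  assumes f: "f \<in> hardy_space" and s: "0 < s1" "s1 \<le> s2" "s2 < 1" and t: "0 < t1" "t1 \<le> t2" "t2 < 1"
  shows "torus_mean f s1 t1 \<le> torus_mean f s2 t2"
proof -
  let ?P = "fibre_pullback f"
  define A where "A = torus_avg (\<lambda>u w. (cmod (?P u w))\<^sup>2)"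
  have hf: "holomorphic2_on f hartogs_triangle" using f by (simp add: hardy_space_def)
  note F = torus_cont_fibre_pullback[OF hf]
  have F2: "torus_cont (\<lambda>u w. (cmod (?P u w))\<^sup>2)"
    using F unfolding case_prod_unfold by (intro continuous_intros)
  have tm: "torus_mean f s t = s * A s t" if "0 < s" "s < 1" "0 < t" "t < 1" for s t
    unfolding A_def by (rule torus_mean_eq_torus_avg[OF hf that])
  obtain C where C: "\<And>s t. 0 < s \<Longrightarrow> s < 1 \<Longrightarrow> 0 < t \<Longrightarrow> t < 1 \<Longrightarrow> torus_mean f s t \<le> C"
    using f by (fastforce simp: hardy_space_def bdd_above_def)
  have A0: "A s t \<ge> 0" if "0 < s" "s < 1" "0 < t" "t < 1" for s t
    using torus_avg_mono[OF _ F2 that, of "\<lambda>_ _. 0"] by (simp add: torus_avg_const A_def)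
  have in_s: "A s1 t1 \<le> A s2 t1"
  proof -
    have t1: "0 < t1" "t1 < 1" "of_real t1 \<in> punctured_disc" using t by auto
    define \<Phi> where "\<Phi> = (\<lambda>\<zeta> (\<gamma>, \<theta>). ?P (\<zeta> * cis \<theta>) (of_real t1 * cis \<gamma>))"
    have sq: "(cmod (\<Phi> \<zeta> x))\<^sup>2 = (\<lambda>(\<gamma>, \<theta>). (cmod (?P (\<zeta> * cis \<theta>) (of_real t1 * cis \<gamma>)))\<^sup>2) x" for \<zeta> x
      by (simp add: \<Phi>_def case_prod_unfold)
    have "continuous_on (cball 0 (1/2) \<times> sphere 0 t1) (\<lambda>(u, w). ?P u w)"
      by (rule continuous_on_subset[OF continuous_on_fibre_pullback[OF hf]]) (use t1 in auto)
    then have "compact ((\<lambda>(u, w). ?P u w) ` (cball 0 (1/2) \<times> sphere 0 t1))"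
      by (intro compact_continuous_image compact_Times) auto
    then obtain B where B: "\<And>u w. cmod u \<le> 1/2 \<Longrightarrow> cmod w = t1 \<Longrightarrow> cmod (?P u w) \<le> B"
      by (fastforce dest!: compact_imp_bounded simp: bounded_iff)
    have "integral torus_box (\<lambda>x. (cmod (\<Phi> (of_real s1) x))\<^sup>2) \<le> integral torus_box (\<lambda>x. (cmod (\<Phi> (of_real s2) x))\<^sup>2)"
    proof (rule square_integral_mono_radius)
      show "continuous_on (punctured_disc \<times> torus_box) (\<lambda>(\<zeta>, x). \<Phi> \<zeta> x)"
        unfolding \<Phi>_def case_prod_unfold
        by (rule continuous_on_compose2[OF F, of _ "\<lambda>p. (fst p * cis (snd (snd p)), of_real t1 * cis (fst (snd p)))", simplified])
          (use t1 in \<open>auto intro!: continuous_intros simp: norm_mult\<close>)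
    next
      fix x :: "real \<times> real"
      have "((\<lambda>u. ?P u (of_real t1 * cis (fst x))) \<circ> (\<lambda>\<zeta>. \<zeta> * cis (snd x))) holomorphic_on punctured_disc"
        by (rule holomorphic_on_compose_gen[OF _ fibre_pullback_holomorphic_1[OF hf]])
          (use t1 in \<open>auto intro!: holomorphic_intros simp: norm_mult\<close>)
      then show "(\<lambda>\<zeta>. \<Phi> \<zeta> x) holomorphic_on punctured_disc"
        by (simp add: \<Phi>_def o_def case_prod_unfold)
    next
      fix \<zeta> assume "\<zeta> \<in> punctured_disc"
      from torus_box_integral_rotate[OF F2 this t1(3)] torus_box_integral_rotate[OF F2 _ t1(3), of "of_real (cmod \<zeta>)"] \<open>\<zeta> \<in> punctured_disc\<close>
      show "integral torus_box (\<lambda>x. (cmod (\<Phi> \<zeta> x))\<^sup>2) = integral torus_box (\<lambda>x. (cmod (\<Phi> (of_real (cmod \<zeta>)) x))\<^sup>2)"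
        unfolding sq by simp
    next
      fix r :: real assume r: "0 < r" "r < 1/2"
      have "A r t1 \<le> torus_avg (\<lambda>u w. B\<^sup>2) r t1"
        unfolding A_def by (rule torus_avg_mono[OF F2]) (use r t1 in \<open>auto intro!: power_mono B\<close>)
      then have "A r t1 \<le> B\<^sup>2" by (simp add: torus_avg_const)
      then show "integral torus_box (\<lambda>x. (cmod (\<Phi> (of_real r) x))\<^sup>2) \<le> 4 * pi\<^sup>2 * B\<^sup>2"
        by (simp add: A_def torus_avg_def sq field_simps)
    qed (use s in auto)
    then show ?thesis by (simp add: A_def torus_avg_def sq divide_right_mono)
  qed
  have in_t: "A s2 t1 \<le> A s2 t2"
  proof -
    have s2: "0 < s2" "s2 < 1" "of_real s2 \<in> punctured_disc" using s by auto
    define \<Phi> where "\<Phi> = (\<lambda>\<zeta> (\<gamma>, \<theta>). ?P (of_real s2 * cis \<theta>) (\<zeta> * cis \<gamma>))"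
    have sq: "(cmod (\<Phi> \<zeta> x))\<^sup>2 = (\<lambda>(\<gamma>, \<theta>). (cmod (?P (of_real s2 * cis \<theta>) (\<zeta> * cis \<gamma>)))\<^sup>2) x" for \<zeta> x
      by (simp add: \<Phi>_def case_prod_unfold)
    have "integral torus_box (\<lambda>x. (cmod (\<Phi> (of_real t1) x))\<^sup>2) \<le> integral torus_box (\<lambda>x. (cmod (\<Phi> (of_real t2) x))\<^sup>2)"
    proof (rule square_integral_mono_radius)
      show "continuous_on (punctured_disc \<times> torus_box) (\<lambda>(\<zeta>, x). \<Phi> \<zeta> x)"
        unfolding \<Phi>_def case_prod_unfold
        by (rule continuous_on_compose2[OF F, of _ "\<lambda>p. (of_real s2 * cis (snd (snd p)), fst p * cis (fst (snd p)))", simplified])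
          (use s2 in \<open>auto intro!: continuous_intros simp: norm_mult\<close>)
    next
      fix x :: "real \<times> real"
      have "((\<lambda>w. ?P (of_real s2 * cis (snd x)) w) \<circ> (\<lambda>\<zeta>. \<zeta> * cis (fst x))) holomorphic_on punctured_disc"
        by (rule holomorphic_on_compose_gen[OF _ fibre_pullback_holomorphic_2[OF hf]])
          (use s2 in \<open>auto intro!: holomorphic_intros simp: norm_mult\<close>)
      then show "(\<lambda>\<zeta>. \<Phi> \<zeta> x) holomorphic_on punctured_disc"
        by (simp add: \<Phi>_def o_def case_prod_unfold)
    next
      fix \<zeta> assume "\<zeta> \<in> punctured_disc"
      from torus_box_integral_rotate[OF F2 s2(3) this] torus_box_integral_rotate[OF F2 s2(3), of "of_real (cmod \<zeta>)"] \<open>\<zeta> \<in> punctured_disc\<close>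
      show "integral torus_box (\<lambda>x. (cmod (\<Phi> \<zeta> x))\<^sup>2) = integral torus_box (\<lambda>x. (cmod (\<Phi> (of_real (cmod \<zeta>)) x))\<^sup>2)"
        unfolding sq by simp
    next
      fix r :: real assume r: "0 < r" "r < 1/2"
      have "s2 * A s2 r \<le> C" using C[of s2 r] tm[of s2 r] s2 r by auto
      then have "A s2 r \<le> C / s2" using s2 by (simp add: field_simps)
      then show "integral torus_box (\<lambda>x. (cmod (\<Phi> (of_real r) x))\<^sup>2) \<le> 4 * pi\<^sup>2 * (C / s2)"
        using s2 by (simp add: A_def torus_avg_def sq field_simps)
    qed (use t in auto)
    then show ?thesis by (simp add: A_def torus_avg_def sq divide_right_mono)
  qed
  have "s1 * A s1 t1 \<le> s2 * A s2 t2"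
    by (intro mult_mono order_trans[OF in_s in_t] A0) (use s t in auto)
  then show ?thesis using tm s t by auto
qed

text \<open>A mean at radii \<open>s, t\<close> is at most the mean at radii \<open>r, r\<close> once \<open>r\<close> exceeds both, so the
diagonal has the same supremum.\<close>
lemma tendsto_hardy_norm_sq:
  assumes f: "f \<in> hardy_space"
  shows "((\<lambda>r. torus_mean f r r) \<longlongrightarrow> hardy_norm_sq f) (at_left 1)"
proof (rule tendstoI)
  fix e :: real assume e: "e > 0"
  let ?I = "{0<..<1::real} \<times> {0<..<1::real}" and ?T = "\<lambda>(s, t). torus_mean f s t"
  have bdd: "bdd_above (?T ` ?I)" using f by (simp add: hardy_space_def)
  have ne: "?I \<noteq> {}" by (auto simp: greaterThanLessThan_empty_iff)
  obtain s t where st: "0 < s" "s < 1" "0 < t" "t < 1" "hardy_norm_sq f - e < torus_mean f s t"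
    using less_cSUP_iff[OF ne bdd, of "hardy_norm_sq f - e"] e by (auto simp: hardy_norm_sq_def)
  have "eventually (\<lambda>r. max s t < r \<and> r < 1) (at_left (1::real))"
    using st by (auto simp: eventually_at_left_field intro!: exI[of _ "max s t"])
  then show "eventually (\<lambda>r. dist (torus_mean f r r) (hardy_norm_sq f) < e) (at_left 1)"
  proof (rule eventually_mono)
    fix r assume r: "max s t < r \<and> r < 1"
    have "torus_mean f s t \<le> torus_mean f r r"
      by (rule torus_mean_mono[OF f]) (use r st in auto)
    moreover have "torus_mean f r r \<le> hardy_norm_sq f"
      unfolding hardy_norm_sq_def using cSUP_upper[OF _ bdd, of "(r, r)"] r st by auto
    ultimately show "dist (torus_mean f r r) (hardy_norm_sq f) < e"
      using st(5) by (simp add: dist_real_def)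
  qed
qed

section \<open>Elements of the Hardy space\<close>

lemma holomorphic2_on_const: "holomorphic2_on (\<lambda>x. c) S"
  unfolding holomorphic2_on_def
  by (auto intro!: exI[of _ 0] simp: case_prod_unfold)

lemma holomorphic2_on_fst: "holomorphic2_on fst S"
  unfolding holomorphic2_on_def
  by (intro ballI exI[of _ 1] exI[of _ 0]) (auto intro!: derivative_eq_intros simp: case_prod_unfold)

lemma holomorphic2_on_snd: "holomorphic2_on snd S"
  unfolding holomorphic2_on_def
  by (intro ballI exI[of _ 0] exI[of _ 1]) (auto intro!: derivative_eq_intros simp: case_prod_unfold)

lemma holomorphic2_on_add:
  assumes "holomorphic2_on f S" "holomorphic2_on g S"
  shows "holomorphic2_on (\<lambda>x. f x + g x) S"
  unfolding holomorphic2_on_def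
proof
  fix x assume x: "x \<in> S"
  obtain a b c d where "(f has_derivative (\<lambda>(h, k). a * h + b * k)) (at x)"
     "(g has_derivative (\<lambda>(h, k). c * h + d * k)) (at x)"
    using assms x unfolding holomorphic2_on_def by meson
  from has_derivative_add[OF this]
  show "\<exists>a b. ((\<lambda>x. f x + g x) has_derivative (\<lambda>(h, k). a * h + b * k)) (at x)"
    by (intro exI[of _ "a + c"] exI[of _ "b + d"]) (simp add: case_prod_unfold algebra_simps)
qed

lemma holomorphic2_on_mult:
  assumes "holomorphic2_on f S" "holomorphic2_on g S"
  shows "holomorphic2_on (\<lambda>x. f x * g x) S"
  unfolding holomorphic2_on_def
proof
  fix x assume x: "x \<in> S"
  obtain a b c d where "(f has_derivative (\<lambda>(h, k). a * h + b * k)) (at x)"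
     "(g has_derivative (\<lambda>(h, k). c * h + d * k)) (at x)"
    using assms x unfolding holomorphic2_on_def by meson
  from has_derivative_mult[OF this]
  show "\<exists>a b. ((\<lambda>x. f x * g x) has_derivative (\<lambda>(h, k). a * h + b * k)) (at x)"
    by (intro exI[of _ "f x * c + a * g x"] exI[of _ "f x * d + b * g x"])
      (simp add: case_prod_unfold algebra_simps)
qed

lemma holomorphic2_on_inverse:
  assumes "holomorphic2_on f S" "\<And>x. x \<in> S \<Longrightarrow> f x \<noteq> 0"
  shows "holomorphic2_on (\<lambda>x. inverse (f x)) S"
  unfolding holomorphic2_on_def
proof
  fix x assume x: "x \<in> S"
  obtain a b where "(f has_derivative (\<lambda>(h, k). a * h + b * k)) (at x)"
    using assms x unfolding holomorphic2_on_def by meson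
  from Deriv.has_derivative_inverse[OF assms(2)[OF x] this]
  show "\<exists>a b. ((\<lambda>x. inverse (f x)) has_derivative (\<lambda>(h, k). a * h + b * k)) (at x)"
    by (intro exI[of _ "- inverse (f x) * a * inverse (f x)"] exI[of _ "- inverse (f x) * b * inverse (f x)"])
      (simp add: case_prod_unfold algebra_simps)
qed

lemma holomorphic2_on_power: "holomorphic2_on f S \<Longrightarrow> holomorphic2_on (\<lambda>x. f x ^ n) S"
  by (induction n) (auto intro: holomorphic2_on_const holomorphic2_on_mult)

lemma holomorphic2_on_sum:
  "(\<And>i. i \<in> I \<Longrightarrow> holomorphic2_on (f i) S) \<Longrightarrow> holomorphic2_on (\<lambda>x. \<Sum>i\<in>I. f i x) S"
  by (induction I rule: infinite_finite_induct) (auto intro: holomorphic2_on_const holomorphic2_on_add)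

lemma holomorphic2_on_cong:
  assumes "open S" "\<And>x. x \<in> S \<Longrightarrow> f x = g x" "holomorphic2_on f S"
  shows "holomorphic2_on g S"
  using assms unfolding holomorphic2_on_def
  by (metis has_derivative_transform_within_open)

lemma open_hartogs_triangle: "open hartogs_triangle"
proof -
  have *: "hartogs_triangle = {p. cmod (fst p) < cmod (snd p)} \<inter> {p. cmod (snd p) < 1}"
    by (auto simp: hartogs_triangle_def)
  show ?thesis unfolding * by (intro open_Int open_Collect_less continuous_intros)
qed

lemma hardy_spaceI:
  assumes "holomorphic2_on f hartogs_triangle" "\<And>x. x \<notin> hartogs_triangle \<Longrightarrow> f x = 0"
    and "\<And>s t. 0 < s \<Longrightarrow> s < 1 \<Longrightarrow> 0 < t \<Longrightarrow> t < 1 \<Longrightarrow> torus_mean f s t \<le> C"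
  shows "f \<in> hardy_space"
  using assms by (auto simp: hardy_space_def intro!: bdd_aboveI2[where M = C])

lemma hardy_space_bound:
  assumes "f \<in> hardy_space"
  obtains C where "\<And>s t. 0 < s \<Longrightarrow> s < 1 \<Longrightarrow> 0 < t \<Longrightarrow> t < 1 \<Longrightarrow> torus_mean f s t \<le> C"
  using assms by (fastforce simp: hardy_space_def bdd_above_def)

lemma hardy_space_holomorphic: "f \<in> hardy_space \<Longrightarrow> holomorphic2_on f hartogs_triangle"
  by (simp add: hardy_space_def)

lemma hardy_space_outside: "f \<in> hardy_space \<Longrightarrow> x \<notin> hartogs_triangle \<Longrightarrow> f x = 0"
  by (cases x) (simp add: hardy_space_def)

lemma torus_cont_norm_sq:
  "holomorphic2_on f hartogs_triangle \<Longrightarrow> torus_cont (\<lambda>u w. (cmod (fibre_pullback f u w))\<^sup>2)"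
  using torus_cont_fibre_pullback[of f] unfolding case_prod_unfold by (intro continuous_intros)

lemma fibre_pullback_add: "fibre_pullback (f + g) u w = fibre_pullback f u w + fibre_pullback g u w"
  by (simp add: fibre_pullback_def algebra_simps)

lemma fibre_pullback_diff: "fibre_pullback (f - g) u w = fibre_pullback f u w - fibre_pullback g u w"
  by (simp add: fibre_pullback_def algebra_simps)

lemma fibre_pullback_fscale: "fibre_pullback (fscale c f) u w = c * fibre_pullback f u w"
  by (simp add: fibre_pullback_def fscale_def)

lemma hardy_space_add:
  assumes f: "f \<in> hardy_space" and g: "g \<in> hardy_space"
  shows "f + g \<in> hardy_space"
proof -
  obtain C where C: "\<And>s t. 0 < s \<Longrightarrow> s < 1 \<Longrightarrow> 0 < t \<Longrightarrow> t < 1 \<Longrightarrow> torus_mean f s t \<le> C"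
    using hardy_space_bound[OF f] by blast
  obtain D where D: "\<And>s t. 0 < s \<Longrightarrow> s < 1 \<Longrightarrow> 0 < t \<Longrightarrow> t < 1 \<Longrightarrow> torus_mean g s t \<le> D"
    using hardy_space_bound[OF g] by blast
  have hf: "holomorphic2_on f hartogs_triangle" and hg: "holomorphic2_on g hartogs_triangle"
    using f g by (auto simp: hardy_space_holomorphic)
  have hfg: "holomorphic2_on (f + g) hartogs_triangle"
    using holomorphic2_on_add[OF hf hg] by (simp add: plus_fun_def)
  show ?thesis
  proof (rule hardy_spaceI[where C = "2 * C + 2 * D"])
    fix s t :: real assume st: "0 < s" "s < 1" "0 < t" "t < 1"
    let ?N = "\<lambda>f u w. (cmod (fibre_pullback f u w))\<^sup>2"
    have c: "torus_cont (\<lambda>u w. 2 * ?N f u w)" "torus_cont (\<lambda>u w. 2 * ?N g u w)"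
      using torus_cont_norm_sq[OF hf] torus_cont_norm_sq[OF hg]
      unfolding case_prod_unfold by (auto intro!: continuous_on_mult_left)
    have "torus_avg (?N (f + g)) s t \<le> torus_avg (\<lambda>u w. 2 * ?N f u w + 2 * ?N g u w) s t"
    proof (rule torus_avg_mono[OF torus_cont_norm_sq[OF hfg] _ st])
      show "torus_cont (\<lambda>u w. 2 * ?N f u w + 2 * ?N g u w)"
        using c unfolding case_prod_unfold by (rule continuous_on_add)
      fix u w
      have "(cmod (x + y))\<^sup>2 \<le> 2 * (cmod x)\<^sup>2 + 2 * (cmod y)\<^sup>2" for x y
      proof -
        have "(cmod (x + y))\<^sup>2 \<le> (cmod x + cmod y)\<^sup>2" by (intro power_mono norm_triangle_ineq) auto
        also have "\<dots> \<le> (cmod x + cmod y)\<^sup>2 + (cmod x - cmod y)\<^sup>2" by simp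
        also have "\<dots> = 2 * (cmod x)\<^sup>2 + 2 * (cmod y)\<^sup>2" by (simp add: power2_eq_square algebra_simps)
        finally show ?thesis .
      qed
      then show "?N (f + g) u w \<le> 2 * ?N f u w + 2 * ?N g u w" by (simp add: fibre_pullback_add)
    qed
    also have "\<dots> = 2 * torus_avg (?N f) s t + 2 * torus_avg (?N g) s t"
      by (simp add: torus_avg_add[OF c st] torus_avg_mult_left)
    finally have "s * torus_avg (?N (f + g)) s t \<le> s * (2 * torus_avg (?N f) s t + 2 * torus_avg (?N g) s t)"
      using st by (intro mult_left_mono) auto
    then have "torus_mean (f + g) s t \<le> 2 * torus_mean f s t + 2 * torus_mean g s t"
      using torus_mean_eq_torus_avg[OF hfg st] torus_mean_eq_torus_avg[OF hf st] torus_mean_eq_torus_avg[OF hg st]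
      by (simp add: algebra_simps)
    then show "torus_mean (f + g) s t \<le> 2 * C + 2 * D" using C[OF st] D[OF st] by simp
  qed (use hfg f g in \<open>auto simp: hardy_space_outside\<close>)
qed

lemma hardy_space_bounded_mult:
  assumes \<phi>: "holomorphic2_on \<phi> hartogs_triangle" "\<And>x. x \<in> hartogs_triangle \<Longrightarrow> cmod (\<phi> x) \<le> B"
    and g: "g \<in> hardy_space"
  shows "\<phi> * g \<in> hardy_space"
proof -
  obtain D where D: "\<And>s t. 0 < s \<Longrightarrow> s < 1 \<Longrightarrow> 0 < t \<Longrightarrow> t < 1 \<Longrightarrow> torus_mean g s t \<le> D"
    using hardy_space_bound[OF g] by blast
  have hg: "holomorphic2_on g hartogs_triangle" using g by (auto simp: hardy_space_holomorphic)
  have h: "holomorphic2_on (\<phi> * g) hartogs_triangle"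
    using holomorphic2_on_mult[OF \<phi>(1) hg] by (simp add: times_fun_def)
  show ?thesis
  proof (rule hardy_spaceI[where C = "B\<^sup>2 * D"])
    fix s t :: real assume st: "0 < s" "s < 1" "0 < t" "t < 1"
    let ?N = "\<lambda>f u w. (cmod (fibre_pullback f u w))\<^sup>2"
    have "torus_avg (?N (\<phi> * g)) s t \<le> torus_avg (\<lambda>u w. B\<^sup>2 * ?N g u w) s t"
    proof (rule torus_avg_mono[OF torus_cont_norm_sq[OF h] _ st])
      show "torus_cont (\<lambda>u w. B\<^sup>2 * ?N g u w)"
        using torus_cont_norm_sq[OF hg] unfolding case_prod_unfold by (rule continuous_on_mult_left)
      fix u w assume "cmod u = s" "cmod w = t"
      then have "(u * w, w) \<in> hartogs_triangle" using st by (intro mem_hartogs_triangle_fibre) auto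
      then have "(cmod (\<phi> (u * w, w)))\<^sup>2 \<le> B\<^sup>2" by (intro power_mono \<phi>(2)) auto
      then show "?N (\<phi> * g) u w \<le> B\<^sup>2 * ?N g u w"
        using mult_right_mono[of "(cmod (\<phi> (u * w, w)))\<^sup>2" "B\<^sup>2" "(cmod (w * g (u * w, w)))\<^sup>2"]
        by (simp add: fibre_pullback_def norm_mult power_mult_distrib mult_ac)
    qed
    then have "s * torus_avg (?N (\<phi> * g)) s t \<le> s * (B\<^sup>2 * torus_avg (?N g) s t)"
      using st by (intro mult_left_mono) (auto simp: torus_avg_mult_left)
    then have "torus_mean (\<phi> * g) s t \<le> B\<^sup>2 * torus_mean g s t"
      using torus_mean_eq_torus_avg[OF h st] torus_mean_eq_torus_avg[OF hg st]
      by (simp add: algebra_simps)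
    also have "\<dots> \<le> B\<^sup>2 * D" by (intro mult_left_mono D st) auto
    finally show "torus_mean (\<phi> * g) s t \<le> B\<^sup>2 * D" .
  qed (use h g in \<open>auto simp: hardy_space_outside\<close>)
qed

lemma hardy_space_fscale: "g \<in> hardy_space \<Longrightarrow> fscale c g \<in> hardy_space"
  using hardy_space_bounded_mult[OF holomorphic2_on_const, of c "cmod c" g]
  by (simp add: fscale_def times_fun_def)

lemma hardy_space_diff: "f \<in> hardy_space \<Longrightarrow> g \<in> hardy_space \<Longrightarrow> f - g \<in> hardy_space"
  using hardy_space_add[OF _ hardy_space_fscale, of f g "-1"]
  by (simp add: fscale_def fun_diff_def plus_fun_def)

lemma fibre_pullback_hardy_basis:
  assumes "u \<in> ball 0 1" "w \<in> punctured_disc"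
  shows "fibre_pullback (hardy_basis i j) u w = u ^ i * w ^ j"
  using mem_hartogs_triangle_fibre[OF assms] assms by (simp add: fibre_pullback_def hardy_basis_def)

lemma hardy_basis_in_hardy_space: "hardy_basis i j \<in> hardy_space"
proof -
  let ?g = "\<lambda>x. inverse (snd x) * (fst x * inverse (snd x)) ^ i * snd x ^ j"
  have "holomorphic2_on ?g hartogs_triangle"
    by (intro holomorphic2_on_mult holomorphic2_on_power holomorphic2_on_inverse
        holomorphic2_on_fst holomorphic2_on_snd) (auto simp: hartogs_triangle_def)
  then have h: "holomorphic2_on (hardy_basis i j) hartogs_triangle"
    by (rule holomorphic2_on_cong[OF open_hartogs_triangle, rotated])
      (auto simp: hardy_basis_def field_simps)
  show ?thesis
  proof (rule hardy_spaceI[where C = 1])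
    fix s t :: real assume st: "0 < s" "s < 1" "0 < t" "t < 1"
    have "torus_avg (\<lambda>u w. (cmod (fibre_pullback (hardy_basis i j) u w))\<^sup>2) s t \<le> torus_avg (\<lambda>u w. 1) s t"
    proof (rule torus_avg_mono[OF torus_cont_norm_sq[OF h] _ st])
      fix u w :: complex assume "cmod u = s" "cmod w = t"
      then show "(cmod (fibre_pullback (hardy_basis i j) u w))\<^sup>2 \<le> 1"
        using st by (subst fibre_pullback_hardy_basis) (auto simp: norm_mult norm_power intro!: power_le_one mult_le_one)
    qed auto
    then have "s * torus_avg (\<lambda>u w. (cmod (fibre_pullback (hardy_basis i j) u w))\<^sup>2) s t \<le> s * 1"
      using st by (intro mult_left_mono) (auto simp: torus_avg_const)
    then show "torus_mean (hardy_basis i j) s t \<le> 1"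
      using st unfolding torus_mean_eq_torus_avg[OF h st] by linarith
  qed (auto simp: h, auto simp: hardy_basis_def)
qed

section \<open>Laurent coefficients\<close>

text \<open>The coefficient of \<open>u\<^sup>a w\<^sup>b\<close> in the pullback of \<open>h\<close>. Integer indices let the action
of a monomial be a plain shift. The radii \<open>1/2\<close> are arbitrary.\<close>
definition laurent_coeff :: "(complex \<times> complex \<Rightarrow> complex) \<Rightarrow> int \<Rightarrow> int \<Rightarrow> complex" where
  "laurent_coeff h a b =
     torus_avg (\<lambda>u w. fibre_pullback h u w * u powi (- a) * w powi (- b)) (1/2) (1/2)"

lemma torus_avg_radius_independent:
  assumes F: "torus_cont F"
    and F1: "\<And>w. w \<in> punctured_disc \<Longrightarrow> (\<lambda>u. F u w) holomorphic_on punctured_disc"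
    and F2: "\<And>u. u \<in> punctured_disc \<Longrightarrow> (\<lambda>w. F u w) holomorphic_on punctured_disc"
    and st: "0 < s" "s < 1" "0 < t" "t < 1" and st': "0 < s'" "s' < 1" "0 < t'" "t' < 1"
  shows "torus_avg F s t = torus_avg F s' t'"
proof -
  have m: "of_real s \<in> punctured_disc" "of_real t \<in> punctured_disc"
     "of_real s' \<in> punctured_disc" "of_real t' \<in> punctured_disc"
    using st st' by auto
  have "torus_avg F s t = torus_avg F s' t"
    unfolding torus_avg_def torus_box_integral_iterated(1)[OF F m(1,2)] torus_box_integral_iterated(1)[OF F m(3,2)]
  proof (rule arg_cong[where f = "\<lambda>x. (1 / (4 * pi\<^sup>2)) *\<^sub>R x"], rule Henstock_Kurzweil_Integration.integral_cong)
    fix \<gamma> :: real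
    have "of_real t * cis \<gamma> \<in> punctured_disc" using st by (auto simp: norm_mult)
    from integral_circle_radius_independent[OF F1[OF this] st(1,2) st'(1,2)]
    show "integral {0..2*pi} (\<lambda>\<theta>. F (of_real s * cis \<theta>) (of_real t * cis \<gamma>))
      = integral {0..2*pi} (\<lambda>\<theta>. F (of_real s' * cis \<theta>) (of_real t * cis \<gamma>))" .
  qed
  also have "\<dots> = torus_avg F s' t'"
    unfolding torus_avg_def torus_box_integral_iterated(2)[OF F m(3,2)] torus_box_integral_iterated(2)[OF F m(3,4)]
  proof (rule arg_cong[where f = "\<lambda>x. (1 / (4 * pi\<^sup>2)) *\<^sub>R x"], rule Henstock_Kurzweil_Integration.integral_cong)
    fix \<theta> :: real
    have "of_real s' * cis \<theta> \<in> punctured_disc" using st' by (auto simp: norm_mult)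
    from integral_circle_radius_independent[OF F2[OF this] st(3,4) st'(3,4)]
    show "integral {0..2*pi} (\<lambda>\<gamma>. F (of_real s' * cis \<theta>) (of_real t * cis \<gamma>))
      = integral {0..2*pi} (\<lambda>\<gamma>. F (of_real s' * cis \<theta>) (of_real t' * cis \<gamma>))" .
  qed
  finally show ?thesis .
qed

lemma torus_cont_laurent_term:
  assumes "holomorphic2_on h hartogs_triangle"
  shows "torus_cont (\<lambda>u w. fibre_pullback h u w * u powi a * w powi b)"
  using torus_cont_fibre_pullback[OF assms] unfolding case_prod_unfold
  by (intro continuous_intros) auto

lemma laurent_coeff_radius:
  assumes h: "holomorphic2_on h hartogs_triangle" and st: "0 < s" "s < 1" "0 < t" "t < 1"
  shows "torus_avg (\<lambda>u w. fibre_pullback h u w * u powi (- a) * w powi (- b)) s t = laurent_coeff h a b"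
  unfolding laurent_coeff_def
proof (rule torus_avg_radius_independent[OF torus_cont_laurent_term[OF h] _ _ st])
  show "(\<lambda>u. fibre_pullback h u w * u powi (- a) * w powi (- b)) holomorphic_on punctured_disc"
    if "w \<in> punctured_disc" for w
    by (intro holomorphic_intros holomorphic_on_subset[OF fibre_pullback_holomorphic_1[OF h that]]) auto
  show "(\<lambda>w. fibre_pullback h u w * u powi (- a) * w powi (- b)) holomorphic_on punctured_disc"
    if "u \<in> punctured_disc" for u
    by (intro holomorphic_intros fibre_pullback_holomorphic_2[OF h]) (use that in auto)
qed auto

text \<open>The pullback is holomorphic in \<open>u\<close> on the full disc, and the extra power of \<open>u\<close> vanishes at the
centre.\<close>
lemma laurent_coeff_eq_0_left:
  assumes h: "holomorphic2_on h hartogs_triangle" and a: "a < 0"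
  shows "laurent_coeff h a b = 0"
proof -
  define F where "F = (\<lambda>u w. fibre_pullback h u w * u powi (- a) * w powi (- b))"
  have m: "complex_of_real (1/2) \<in> punctured_disc" by auto
  have "integral torus_box (\<lambda>(\<gamma>, \<theta>). F (of_real (1/2) * cis \<theta>) (of_real (1/2) * cis \<gamma>))
     = integral {0..2*pi} (\<lambda>\<gamma>. integral {0..2*pi} (\<lambda>\<theta>. F (of_real (1/2) * cis \<theta>) (of_real (1/2) * cis \<gamma>)))"
    unfolding F_def by (rule torus_box_integral_iterated(1)[OF torus_cont_laurent_term[OF h] m m])
  also have "\<dots> = integral {0..2*pi} (\<lambda>\<gamma>. 0)"
  proof (rule Henstock_Kurzweil_Integration.integral_cong)
    fix \<gamma> :: real
    let ?w = "of_real (1/2) * cis \<gamma>"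
    have w: "?w \<in> punctured_disc" by (auto simp: norm_mult)
    have "(\<lambda>u. fibre_pullback h u ?w * u ^ nat (- a) * ?w powi (- b)) holomorphic_on ball 0 1"
      by (intro holomorphic_intros fibre_pullback_holomorphic_1[OF h w])
    then have "(\<lambda>u. F u ?w) holomorphic_on ball 0 1"
      using a by (simp add: F_def power_int_def)
    moreover have "F 0 ?w = 0" using a by (simp add: F_def)
    ultimately show "integral {0..2*pi} (\<lambda>\<theta>. F (of_real (1/2) * cis \<theta>) ?w) = 0"
      using integral_circle_mean_value[of "\<lambda>u. F u ?w" "1/2"] by simp
  qed
  finally show ?thesis unfolding laurent_coeff_def torus_avg_def F_def by simp
qed

text \<open>The \<open>L\<^sup>1\<close> average of the pullback is bounded uniformly in \<open>t\<close>, since \<open>\<bar>x\<bar> \<le> (1 + \<bar>x\<bar>\<^sup>2) / 2\<close>; the factor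
\<open>\<bar>w powi - b\<bar> \<le> t\<close> then forces the coefficient to \<open>0\<close> as \<open>t\<close> does.\<close>
lemma laurent_coeff_eq_0_right:
  assumes h: "h \<in> hardy_space" and b: "b < 0"
  shows "laurent_coeff h a b = 0"
proof -
  have hol: "holomorphic2_on h hartogs_triangle" using h by (rule hardy_space_holomorphic)
  obtain C where C: "\<And>s t. 0 < s \<Longrightarrow> s < 1 \<Longrightarrow> 0 < t \<Longrightarrow> t < 1 \<Longrightarrow> torus_mean h s t \<le> C"
    using hardy_space_bound[OF h] by blast
  define N where "N = (\<lambda>u w. (cmod (fibre_pullback h u w))\<^sup>2)"
  have cN: "torus_cont N" unfolding N_def by (rule torus_cont_norm_sq[OF hol])
  define K where "K = (1/2) powi (- a) * (1 + 2 * C) / 2"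
  have bound: "cmod (laurent_coeff h a b) \<le> t * K" if t: "0 < t" "t < 1" for t
  proof -
    have st: "0 < (1/2::real)" "(1/2::real) < 1" "0 < t" "t < 1" using t by auto
    define c where "c = (1/2) powi (- a) * t / 2"
    have "c \<ge> 0" using t by (simp add: c_def)
    have cN': "torus_cont (\<lambda>u w. 1 + N u w)" "torus_cont (\<lambda>u w. c * (1 + N u w))"
      using cN unfolding case_prod_unfold by (auto intro!: continuous_intros)
    have "cmod (laurent_coeff h a b) \<le> torus_avg (\<lambda>u w. c * (1 + N u w)) (1/2) t"
      unfolding laurent_coeff_radius[OF hol st, symmetric]
    proof (rule norm_torus_avg_le[OF torus_cont_laurent_term[OF hol] cN'(2) st])
      fix u w :: complex assume uw: "cmod u = 1/2" "cmod w = t"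
      let ?x = "cmod (fibre_pullback h u w)"
      have "0 \<le> (?x - 1)\<^sup>2" by simp
      then have x: "?x \<le> (1 + N u w) / 2" by (simp add: N_def power2_eq_square algebra_simps)
      have "t powi (- b) = t ^ nat (- b)" using b by (simp add: power_int_def)
      also have "\<dots> \<le> t ^ 1" using t b by (intro power_decreasing) auto
      finally have tb: "t powi (- b) \<le> t" by simp
      have "cmod (fibre_pullback h u w * u powi (- a) * w powi (- b)) = ?x * (1/2) powi (- a) * t powi (- b)"
        by (simp add: norm_mult norm_power_int uw)
      also have "\<dots> \<le> ((1 + N u w) / 2) * (1/2) powi (- a) * t"
        using t by (intro mult_mono x tb) (auto simp: N_def)
      also have "\<dots> = c * (1 + N u w)" by (simp add: c_def mult_ac)
      finally show "cmod (fibre_pullback h u w * u powi (- a) * w powi (- b)) \<le> c * (1 + N u w)" .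
    qed
    also have "\<dots> = c * (1 + torus_avg N (1/2) t)"
      using torus_avg_add[OF _ cN st, of "\<lambda>_ _. 1"] by (simp add: torus_avg_mult_left torus_avg_const)
    also have "torus_avg N (1/2) t \<le> 2 * C"
      using C[OF st] torus_mean_eq_torus_avg[OF hol st] by (simp add: N_def)
    finally have "cmod (laurent_coeff h a b) \<le> c * (1 + 2 * C)"
      using \<open>c \<ge> 0\<close> by (simp add: mult_left_mono)
    then show ?thesis by (simp add: c_def K_def mult_ac)
  qed
  have "((\<lambda>t. t * K) \<longlongrightarrow> 0 * K) (at_right 0)" by (intro tendsto_intros)
  moreover have "eventually (\<lambda>t::real. 0 < t \<and> t < 1) (at_right 0)"
    by (auto simp: eventually_at_right_field intro!: exI[of _ 1])
  then have "eventually (\<lambda>t. cmod (laurent_coeff h a b) \<le> t * K) (at_right 0)"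
    by eventually_elim (use bound in auto)
  ultimately have "cmod (laurent_coeff h a b) \<le> 0 * K"
    by (rule tendsto_lowerbound) auto
  then show ?thesis by simp
qed

text \<open>A homogeneous function of degree \<open>(n, k)\<close> has average proportional to \<open>s powi n * t powi k\<close>, but the
average of a holomorphic function does not depend on the radii.\<close>
lemma torus_avg_monomial:
  "torus_avg (\<lambda>u w. u powi n * w powi k) (1/2) (1/2) = (if n = 0 \<and> k = 0 then 1 else 0)"
proof -
  have hom: "torus_avg (\<lambda>u w. u powi n * w powi k) s t
     = of_real (s powi n * t powi k) * torus_avg (\<lambda>u w. u powi n * w powi k) 1 1" for s t
    unfolding torus_avg_mult_left[symmetric]
    by (simp add: torus_avg_def power_int_mult_distrib mult_ac)
  have indep: "torus_avg (\<lambda>u w. u powi n * w powi k) s t = torus_avg (\<lambda>u w. u powi n * w powi k) (1/2) (1/2)"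
    if st: "0 < s" "s < 1" "0 < t" "t < 1" for s t
    by (rule torus_avg_radius_independent[OF _ _ _ st])
      (auto intro!: continuous_intros holomorphic_intros simp: case_prod_unfold)
  \<comment> \<open>Changing one radius from \<open>1/2\<close> to \<open>1/4\<close> detects a nonzero exponent.\<close>
  have ne: "(1/2::real) powi j \<noteq> (1/4) powi j" if "j \<noteq> 0" for j :: int
  proof
    assume "(1/2::real) powi j = (1/4) powi j"
    moreover have "(1/4::real) powi j = (1/2) powi j * (1/2) powi j"
      by (simp add: power_int_mult_distrib[symmetric])
    ultimately have "(1/2::real) powi j = 1" by simp
    then have "(2::real) ^ nat j = 1" "(2::real) ^ nat (- j) = 1"
      by (auto simp: power_int_def power_one_over split: if_splits)
    then show False using that one_less_power[of "2::real" "nat j"] one_less_power[of "2::real" "nat (- j)"]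
      by (cases "j > 0") auto
  qed
  let ?K = "torus_avg (\<lambda>u w. u powi n * w powi k) 1 1 :: complex"
  consider "n = 0" "k = 0" | "n \<noteq> 0" | "k \<noteq> 0" by blast
  then show ?thesis
  proof cases
    case 1 then show ?thesis by (simp add: torus_avg_const)
  next
    case 2
    have "of_real ((1/4) powi n * (1/2) powi k) * ?K = of_real ((1/2) powi n * (1/2) powi k) * ?K"
      using indep[of "1/4" "1/2"] hom[of "1/4" "1/2"] hom[of "1/2" "1/2"] by simp
    then have "?K = 0" using ne[OF 2] by (simp only: mult_cancel_right of_real_eq_iff) auto
    then show ?thesis using 2 hom[of "1/2" "1/2"] by simp
  next
    case 3
    have "of_real ((1/2) powi n * (1/4) powi k) * ?K = of_real ((1/2) powi n * (1/2) powi k) * ?K"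
      using indep[of "1/2" "1/4"] hom[of "1/2" "1/4"] hom[of "1/2" "1/2"] by simp
    then have "?K = 0" using ne[OF 3] by (simp only: mult_cancel_right of_real_eq_iff) auto
    then show ?thesis using 3 hom[of "1/2" "1/2"] by simp
  qed
qed

lemma laurent_coeff_hardy_basis:
  "laurent_coeff (hardy_basis i j) a b = (if a = int i \<and> b = int j then 1 else 0)"
proof -
  have "laurent_coeff (hardy_basis i j) a b = torus_avg (\<lambda>u w. u powi (int i - a) * w powi (int j - b)) (1/2) (1/2)"
    unfolding laurent_coeff_def
  proof (rule torus_avg_cong)
    fix u w :: complex assume "cmod u = 1/2" "cmod w = 1/2"
    then have "u \<in> ball 0 1" "w \<in> punctured_disc" "u \<noteq> 0" "w \<noteq> 0" by auto
    then show "fibre_pullback (hardy_basis i j) u w * u powi (- a) * w powi (- b) = u powi (int i - a) * w powi (int j - b)"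
      by (simp add: fibre_pullback_hardy_basis power_int_diff power_int_minus field_simps)
  qed auto
  then show ?thesis by (auto simp: torus_avg_monomial)
qed

section \<open>The inner product with a homogeneous element\<close>

text \<open>Each of the four norms in the polarization formula is a limit of torus means, and before passing
to the limit polarization is the pointwise identity for \<open>x * cnj y\<close>.\<close>
lemma tendsto_hardy_inner:
  assumes f: "f \<in> hardy_space" and g: "g \<in> hardy_space"
  shows "((\<lambda>r. of_real r * torus_avg (\<lambda>u w. fibre_pullback f u w * cnj (fibre_pullback g u w)) r r)
    \<longlongrightarrow> hardy_inner f g) (at_left 1)"
proof -
  let ?T = "\<lambda>h r. complex_of_real (torus_mean h r r)"
  let ?N = "\<lambda>h u w. complex_of_real ((cmod (fibre_pullback h u w))\<^sup>2)"
  let ?a = "f + g" and ?b = "f - g" and ?c = "f + fscale \<i> g" and ?d = "f - fscale \<i> g"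
  have mem: "?a \<in> hardy_space" "?b \<in> hardy_space" "?c \<in> hardy_space" "?d \<in> hardy_space"
    by (intro hardy_space_add hardy_space_diff hardy_space_fscale f g)+
  have lim: "((\<lambda>r. 1/4 * (?T ?a r - ?T ?b r + \<i> * ?T ?c r - \<i> * ?T ?d r)) \<longlongrightarrow> hardy_inner f g) (at_left 1)"
    unfolding hardy_inner_def by (intro tendsto_intros tendsto_hardy_norm_sq mem)
  have eq: "1/4 * (?T ?a r - ?T ?b r + \<i> * ?T ?c r - \<i> * ?T ?d r)
      = of_real r * torus_avg (\<lambda>u w. fibre_pullback f u w * cnj (fibre_pullback g u w)) r r"
    if r: "0 < r" "r < 1" for r
  proof -
    note rr = r r
    have T: "?T h r = of_real r * torus_avg (?N h) r r" if "h \<in> hardy_space" for h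
    proof -
      have hol: "holomorphic2_on h hartogs_triangle" using that by (rule hardy_space_holomorphic)
      show ?thesis
        using torus_mean_eq_torus_avg[OF hol rr] torus_avg_of_real[OF torus_cont_norm_sq[OF hol] rr] by simp
    qed
    have cN: "torus_cont (\<lambda>u w. k * ?N h u w)" if "h \<in> hardy_space" for h k
      using torus_cont_norm_sq[OF hardy_space_holomorphic[OF that]]
      unfolding case_prod_unfold by (intro continuous_on_mult_left continuous_on_of_real)
    have cont_add: "torus_cont (\<lambda>u w. F u w + G u w)" if "torus_cont F" "torus_cont G" for F G :: "complex \<Rightarrow> complex \<Rightarrow> complex"
      using that unfolding case_prod_unfold by (rule continuous_on_add)
    have polar: "x * cnj y = (1/4) * of_real ((cmod (x + y))\<^sup>2) + ((-1/4) * of_real ((cmod (x - y))\<^sup>2)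
        + ((\<i>/4) * of_real ((cmod (x + \<i> * y))\<^sup>2) + (-\<i>/4) * of_real ((cmod (x - \<i> * y))\<^sup>2)))" for x y
      unfolding of_real_power complex_norm_square[unfolded of_real_power] by (simp add: algebra_simps)
    have "torus_avg (\<lambda>u w. fibre_pullback f u w * cnj (fibre_pullback g u w)) r r
      = torus_avg (\<lambda>u w. (1/4) * ?N ?a u w + ((-1/4) * ?N ?b u w + ((\<i>/4) * ?N ?c u w + (-\<i>/4) * ?N ?d u w))) r r"
      by (rule arg_cong[where f = "\<lambda>F. torus_avg F r r"], intro ext, subst polar)
        (simp only: fibre_pullback_add fibre_pullback_diff fibre_pullback_fscale)
    also have "\<dots> = (1/4) * torus_avg (?N ?a) r r + ((-1/4) * torus_avg (?N ?b) r r
        + ((\<i>/4) * torus_avg (?N ?c) r r + (-\<i>/4) * torus_avg (?N ?d) r r))"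
      by (subst torus_avg_add[OF cN cont_add[OF cN cont_add[OF cN cN]] rr], (rule mem)+,
          subst torus_avg_add[OF cN cont_add[OF cN cN] rr], (rule mem)+,
          subst torus_avg_add[OF cN cN rr], (rule mem)+, simp only: torus_avg_mult_left)
    finally have cross: "torus_avg (\<lambda>u w. fibre_pullback f u w * cnj (fibre_pullback g u w)) r r = \<dots>" .
    show ?thesis unfolding T[OF mem(1)] T[OF mem(2)] T[OF mem(3)] T[OF mem(4)] cross
      by (simp add: algebra_simps)
  qed
  have "eventually (\<lambda>r::real. 0 < r \<and> r < 1) (at_left 1)"
    by (auto simp: eventually_at_left_field intro!: exI[of _ 0])
  then have "eventually (\<lambda>r. 1/4 * (?T ?a r - ?T ?b r + \<i> * ?T ?c r - \<i> * ?T ?d r)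
      = of_real r * torus_avg (\<lambda>u w. fibre_pullback f u w * cnj (fibre_pullback g u w)) r r) (at_left 1)"
    by eventually_elim (use eq in blast)
  then show ?thesis using lim by (rule Lim_transform_eventually[rotated])
qed

lemma sum_fun_apply: "(\<Sum>i\<in>I. f i) x = (\<Sum>i\<in>I. f i x)"
  by (induction I rule: infinite_finite_induct) simp_all

text \<open>The index \<open>a\<close> is the exponent of \<open>z / w\<close>, so \<open>hardy_basis a (m - a)\<close> has total degree \<open>m\<close>.\<close>
definition homogeneous :: "nat \<Rightarrow> (nat \<Rightarrow> complex) \<Rightarrow> complex \<times> complex \<Rightarrow> complex" where
  "homogeneous m c = (\<Sum>a\<le>m. fscale (c a) (hardy_basis a (m - a)))"

lemma zero_in_hardy_space: "0 \<in> hardy_space"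
  using hardy_space_fscale[OF hardy_basis_in_hardy_space, of 0 0 0] by (simp add: fscale_def zero_fun_def)

lemma homogeneous_in_hardy_space: "homogeneous m c \<in> hardy_space"
proof -
  have "(\<Sum>a\<in>A. fscale (c a) (hardy_basis a (m - a))) \<in> hardy_space" if "finite A" for A
    using that
  proof induction
    case empty
    show ?case by (simp only: sum.empty zero_in_hardy_space)
  next
    case (insert a A)
    show ?case
      unfolding sum.insert[OF insert.hyps]
      by (intro hardy_space_add hardy_space_fscale hardy_basis_in_hardy_space insert.IH)
  qed
  then show ?thesis by (simp add: homogeneous_def)
qed

lemma homogeneous_add: "homogeneous m (\<lambda>a. c a + d a) = homogeneous m c + homogeneous m d"
  by (simp add: homogeneous_def cfun.scale_left_distrib sum.distrib)

lemma homogeneous_scale: "homogeneous m (\<lambda>a. k * c a) = fscale k (homogeneous m c)"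
  by (simp add: homogeneous_def cfun.scale_sum_right)

lemma homogeneous_zero: "homogeneous m (\<lambda>a. 0) = 0"
  by (simp add: homogeneous_def)

lemma homogeneous_sum: "homogeneous m (\<lambda>a. \<Sum>i\<in>I. k i * c i a) = (\<Sum>i\<in>I. fscale (k i) (homogeneous m (c i)))"
  by (induction I rule: infinite_finite_induct)
    (simp_all add: homogeneous_add homogeneous_scale homogeneous_zero)

lemma homogeneous_cong: "(\<And>a. a \<le> m \<Longrightarrow> c a = d a) \<Longrightarrow> homogeneous m c = homogeneous m d"
  by (simp add: homogeneous_def)

text \<open>Parametrizing by the exponent \<open>a\<close> of \<open>z / w\<close> turns membership questions into conditions on
a coefficient sequence.\<close>
lemma F_space_eq_homogeneous: "F_space m = range (homogeneous m)"
proof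
  have "cfun.subspace (range (homogeneous m))"
  proof (rule cfun.subspaceI)
    show "0 \<in> range (homogeneous m)" by (rule range_eqI, rule homogeneous_zero[symmetric])
    show "f + g \<in> range (homogeneous m)" if "f \<in> range (homogeneous m)" "g \<in> range (homogeneous m)" for f g
      using that by (elim rangeE) (simp only: homogeneous_add[symmetric] rangeI)
    show "fscale k f \<in> range (homogeneous m)" if "f \<in> range (homogeneous m)" for k f
      using that by (elim rangeE) (simp only: homogeneous_scale[symmetric] rangeI)
  qed
  moreover have "hardy_basis (m - j) j \<in> range (homogeneous m)" if "j \<le> m" for j
  proof (rule range_eqI)
    have "homogeneous m (\<lambda>a. if a = m - j then 1 else 0)
      = (\<Sum>a\<le>m. if a = m - j then hardy_basis a (m - a) else 0)"
      unfolding homogeneous_def by (rule sum.cong) (auto simp: fscale_def)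
    also have "\<dots> = hardy_basis (m - j) j" using that by simp
    finally show "hardy_basis (m - j) j = homogeneous m (\<lambda>a. if a = m - j then 1 else 0)" ..
  qed
  ultimately show "F_space m \<subseteq> range (homogeneous m)"
    unfolding F_space_def by (intro cfun.span_minimal) auto
  have "homogeneous m c \<in> F_space m" for c
    unfolding homogeneous_def F_space_def
  proof (intro cfun.span_sum cfun.span_scale cfun.span_base)
    fix a assume "a \<in> {..m}"
    then show "hardy_basis a (m - a) \<in> {hardy_basis (m - j) j |j. j \<le> m}"
      by (auto intro!: exI[of _ "m - a"])
  qed
  then show "range (homogeneous m) \<subseteq> F_space m" by auto
qed

text \<open>On the torus with both radii \<open>r\<close>, \<open>u\<^sup>a = r\<^bsup>2 a\<^esup> cnj (u powi - a)\<close>, and likewise for \<open>w\<close>. So the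
average against \<open>cnj h\<close> is the conjugate of a Laurent coefficient, up to a power of \<open>r\<close> that tends to \<open>1\<close>.\<close>
lemma hardy_inner_homogeneous:
  assumes h: "h \<in> hardy_space"
  shows "hardy_inner (homogeneous m c) h = (\<Sum>a\<le>m. c a * cnj (laurent_coeff h (int a) (int (m - a))))"
proof -
  let ?P = "fibre_pullback" and ?L = "\<lambda>a. laurent_coeff h (int a) (int (m - a))"
  have hol: "holomorphic2_on h hartogs_triangle" using h by (rule hardy_space_holomorphic)
  have eq: "of_real r * torus_avg (\<lambda>u w. ?P (homogeneous m c) u w * cnj (?P h u w)) r r
     = of_real r * (\<Sum>a\<le>m. c a * of_real (r ^ (2 * m)) * cnj (?L a))" if r: "0 < r" "r < 1" for r
  proof -
    note rr = r r
    let ?t = "\<lambda>a u w. ?P h u w * u powi (- int a) * w powi (- int (m - a))"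
    have cont: "torus_cont (\<lambda>u w. c a * of_real (r ^ (2 * m)) * cnj (?t a u w))" for a
      using torus_cont_laurent_term[OF hol, of "- int a" "- int (m - a)"]
      unfolding case_prod_unfold by (intro continuous_on_mult_left continuous_on_cnj)
    have "torus_avg (\<lambda>u w. ?P (homogeneous m c) u w * cnj (?P h u w)) r r
      = torus_avg (\<lambda>u w. \<Sum>a\<le>m. c a * of_real (r ^ (2 * m)) * cnj (?t a u w)) r r"
    proof (rule torus_avg_cong)
      fix u w :: complex assume uw: "cmod u = r" "cmod w = r"
      have m: "u \<in> ball 0 1" "w \<in> punctured_disc" "u \<noteq> 0" "w \<noteq> 0" using uw r by auto
      have sq: "v ^ k = of_real (r ^ (2 * k)) * cnj (v powi (- int k))" if "cmod v = r" for v :: complex and k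
      proof -
        have "v * cnj v = of_real (r\<^sup>2)" using that complex_norm_square[of v] by simp
        then have "v ^ k * cnj v ^ k = of_real (r ^ (2 * k))"
          by (simp only: power_mult power_mult_distrib[symmetric] of_real_power)
        moreover have "v \<noteq> 0" using that r by auto
        ultimately show ?thesis
          by (simp add: power_int_minus field_simps)
      qed
      have "?P (homogeneous m c) u w = (\<Sum>a\<le>m. c a * (u ^ a * w ^ (m - a)))"
        by (subst fibre_pullback_hardy_basis[OF m(1,2), symmetric])
          (simp add: homogeneous_def fibre_pullback_def fscale_def sum_distrib_left mult_ac sum_fun_apply)
      then have "?P (homogeneous m c) u w * cnj (?P h u w)
         = (\<Sum>a\<le>m. c a * (u ^ a * w ^ (m - a)) * cnj (?P h u w))"
        by (simp add: sum_distrib_right)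
      also have "\<dots> = (\<Sum>a\<le>m. c a * of_real (r ^ (2 * m)) * cnj (?t a u w))"
      proof (rule sum.cong)
        fix a assume "a \<in> {..m}"
        then have "2 * a + 2 * (m - a) = 2 * m" by simp
        then have e: "complex_of_real (r ^ (2 * a)) * of_real (r ^ (2 * (m - a))) = of_real (r ^ (2 * m))"
          by (simp only: of_real_mult[symmetric] power_add[symmetric])
        have "c a * (u ^ a * w ^ (m - a)) * cnj (?P h u w)
           = c a * ((of_real (r ^ (2 * a)) * cnj (u powi (- int a))) * (of_real (r ^ (2 * (m - a))) * cnj (w powi (- int (m - a))))) * cnj (?P h u w)"
          by (subst sq[OF uw(1)], subst sq[OF uw(2)]) simp
        also have "\<dots> = c a * (of_real (r ^ (2 * a)) * of_real (r ^ (2 * (m - a)))) * cnj (?t a u w)"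
          by (simp add: mult_ac)
        finally show "c a * (u ^ a * w ^ (m - a)) * cnj (?P h u w) = c a * of_real (r ^ (2 * m)) * cnj (?t a u w)"
          unfolding e .
      qed simp
      finally show "?P (homogeneous m c) u w * cnj (?P h u w)
         = (\<Sum>a\<le>m. c a * of_real (r ^ (2 * m)) * cnj (?t a u w))" .
    qed (use r in auto)
    also have "\<dots> = (\<Sum>a\<le>m. torus_avg (\<lambda>u w. c a * of_real (r ^ (2 * m)) * cnj (?t a u w)) r r)"
      by (rule torus_avg_sum[OF _ cont rr]) simp
    also have "\<dots> = (\<Sum>a\<le>m. c a * of_real (r ^ (2 * m)) * cnj (?L a))"
      by (simp only: torus_avg_mult_left torus_avg_cnj laurent_coeff_radius[OF hol rr])
    finally show ?thesis by simp
  qed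
  have "eventually (\<lambda>r::real. 0 < r \<and> r < 1) (at_left 1)"
    by (auto simp: eventually_at_left_field intro!: exI[of _ 0])
  then have ev: "eventually (\<lambda>r. of_real r * torus_avg (\<lambda>u w. ?P (homogeneous m c) u w * cnj (?P h u w)) r r
     = of_real r * (\<Sum>a\<le>m. c a * of_real (r ^ (2 * m)) * cnj (?L a))) (at_left 1)"
    by eventually_elim (use eq in blast)
  have "((\<lambda>r. of_real r * (\<Sum>a\<le>m. c a * of_real (r ^ (2 * m)) * cnj (?L a)))
      \<longlongrightarrow> of_real 1 * (\<Sum>a\<le>m. c a * of_real (1 ^ (2 * m)) * cnj (?L a))) (at_left 1)"
    by (intro tendsto_intros)
  moreover have "((\<lambda>r. of_real r * (\<Sum>a\<le>m. c a * of_real (r ^ (2 * m)) * cnj (?L a)))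
      \<longlongrightarrow> hardy_inner (homogeneous m c) h) (at_left 1)"
    by (rule Lim_transform_eventually[OF tendsto_hardy_inner[OF homogeneous_in_hardy_space h] ev])
  ultimately show ?thesis
    using tendsto_unique[OF trivial_limit_at_left_real] by fastforce
qed

text \<open>Pairing with \<open>hardy_basis a (m - a)\<close> reads off the coefficient \<open>c a\<close>.\<close>
lemma homogeneous_eqD:
  assumes "homogeneous m c = homogeneous m d" "a \<le> m"
  shows "c a = d a"
proof -
  have "hardy_inner (homogeneous m c) (hardy_basis a (m - a)) = c a" for c
  proof -
    have "hardy_inner (homogeneous m c) (hardy_basis a (m - a)) = (\<Sum>x\<le>m. if x = a then c x else 0)"
      unfolding hardy_inner_homogeneous[OF hardy_basis_in_hardy_space] laurent_coeff_hardy_basis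
      by (rule sum.cong) auto
    then show ?thesis using assms(2) by simp
  qed
  then show ?thesis using assms(1) by metis
qed

section \<open>Orthogonality to multiples of a polynomial\<close>

definition monomial_support :: "complex poly poly \<Rightarrow> (nat \<times> nat) set" where
  "monomial_support p = {(k, l). coeff2 p k l \<noteq> 0}"

lemma monomial_support_subset:
  "monomial_support p \<subseteq> Sigma {..degree p} (\<lambda>k. {..degree (coeff p k)})"
proof
  fix x assume "x \<in> monomial_support p"
  then obtain k l where x: "x = (k, l)" "coeff (coeff p k) l \<noteq> 0"
    by (auto simp: monomial_support_def coeff2_def)
  then have "coeff p k \<noteq> 0" by auto
  then show "x \<in> Sigma {..degree p} (\<lambda>k. {..degree (coeff p k)})"
    using x by (auto intro: le_degree)
qed

lemma finite_monomial_support: "finite (monomial_support p)"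
  by (rule finite_subset[OF monomial_support_subset]) auto

lemma eval2_eq_sum: "eval2 p x = (\<Sum>(k, l)\<in>monomial_support p. coeff2 p k l * fst x ^ k * snd x ^ l)"
proof -
  obtain z w where x: "x = (z, w)" by (cases x)
  have "eval2 p x = (\<Sum>k\<le>degree p. poly (coeff p k) w * z ^ k)"
    by (simp add: eval2_def x poly_altdef[of p] poly_sum poly_power)
  also have "\<dots> = (\<Sum>k\<le>degree p. \<Sum>l\<le>degree (coeff p k). coeff2 p k l * z ^ k * w ^ l)"
    by (simp add: poly_altdef sum_distrib_left sum_distrib_right coeff2_def mult_ac)
  also have "\<dots> = (\<Sum>(k, l)\<in>Sigma {..degree p} (\<lambda>k. {..degree (coeff p k)}). coeff2 p k l * z ^ k * w ^ l)"
    by (subst sum.Sigma) auto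
  also have "\<dots> = (\<Sum>(k, l)\<in>monomial_support p. coeff2 p k l * z ^ k * w ^ l)"
    by (rule sum.mono_neutral_right[OF _ monomial_support_subset]) (auto simp: monomial_support_def)
  finally show ?thesis by (simp add: x)
qed

lemma eval2_mult_in_hardy_space:
  assumes "g \<in> hardy_space"
  shows "eval2 p * g \<in> hardy_space"
proof (rule hardy_space_bounded_mult[OF _ _ assms])
  have "eval2 p = (\<lambda>x. \<Sum>(k, l)\<in>monomial_support p. coeff2 p k l * fst x ^ k * snd x ^ l)"
    by (rule ext, rule eval2_eq_sum)
  then show "holomorphic2_on (eval2 p) hartogs_triangle"
    unfolding case_prod_unfold
    by (simp only:) (intro holomorphic2_on_sum holomorphic2_on_mult holomorphic2_on_power holomorphic2_on_const
        holomorphic2_on_fst holomorphic2_on_snd)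
next
  fix x assume x: "x \<in> hartogs_triangle"
  have "cmod (coeff2 p k l * fst x ^ k * snd x ^ l) \<le> cmod (coeff2 p k l)" for k l
  proof -
    have "cmod (fst x) ^ k * cmod (snd x) ^ l \<le> 1"
      using x by (intro mult_le_one power_le_one) (auto simp: hartogs_triangle_def)
    then show ?thesis
      using mult_left_mono[of "cmod (fst x) ^ k * cmod (snd x) ^ l" 1 "cmod (coeff2 p k l)"]
      by (simp add: norm_mult norm_power mult.assoc)
  qed
  then show "cmod (eval2 p x) \<le> (\<Sum>(k, l)\<in>monomial_support p. cmod (coeff2 p k l))"
    unfolding eval2_eq_sum by (intro sum_norm_le) auto
qed

lemma laurent_coeff_eval2_mult:
  assumes g: "g \<in> hardy_space"
  shows "laurent_coeff (eval2 p * g) a b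
    = (\<Sum>(k, l)\<in>monomial_support p. coeff2 p k l * laurent_coeff g (a - int k) (b - int k - int l))"
proof -
  have hol: "holomorphic2_on g hartogs_triangle" using g by (rule hardy_space_holomorphic)
  let ?t = "\<lambda>k l u w. fibre_pullback g u w * u powi (- (a - int k)) * w powi (- (b - int k - int l))"
  have "laurent_coeff (eval2 p * g) a b
     = torus_avg (\<lambda>u w. \<Sum>x\<in>monomial_support p. coeff2 p (fst x) (snd x) * ?t (fst x) (snd x) u w) (1/2) (1/2)"
    unfolding laurent_coeff_def
  proof (rule torus_avg_cong)
    fix u w :: complex assume "cmod u = 1/2" "cmod w = 1/2"
    then have ne: "u \<noteq> 0" "w \<noteq> 0" by auto
    have "fibre_pullback (eval2 p * g) u w * u powi (- a) * w powi (- b)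
      = (\<Sum>x\<in>monomial_support p. coeff2 p (fst x) (snd x) * (u * w) ^ fst x * w ^ snd x)
          * (fibre_pullback g u w * u powi (- a) * w powi (- b))"
      by (simp add: fibre_pullback_def eval2_eq_sum case_prod_unfold mult_ac)
    also have "\<dots> = (\<Sum>x\<in>monomial_support p. coeff2 p (fst x) (snd x) * ?t (fst x) (snd x) u w)"
      unfolding sum_distrib_right using ne
      by (intro sum.cong) (simp_all add: power_int_diff power_int_minus power_int_add power_mult_distrib field_simps)
    finally show "fibre_pullback (eval2 p * g) u w * u powi (- a) * w powi (- b)
      = (\<Sum>x\<in>monomial_support p. coeff2 p (fst x) (snd x) * ?t (fst x) (snd x) u w)" .
  qed auto
  also have "\<dots> = (\<Sum>x\<in>monomial_support p. torus_avg (\<lambda>u w. coeff2 p (fst x) (snd x) * ?t (fst x) (snd x) u w) (1/2) (1/2))"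
  proof (rule torus_avg_sum[OF finite_monomial_support])
    show "torus_cont (\<lambda>u w. coeff2 p (fst x) (snd x) * ?t (fst x) (snd x) u w)" for x
      using torus_cont_laurent_term[OF hol] unfolding case_prod_unfold by (rule continuous_on_mult_left)
  qed auto
  finally show ?thesis by (simp only: torus_avg_mult_left laurent_coeff_def[symmetric] case_prod_unfold)
qed

text \<open>The inner product of \<open>homogeneous m c\<close> with \<open>p * hardy_basis i j\<close>, that is, the \<open>(i, j)\<close>
coefficient of the adjoint of multiplication by \<open>p\<close> applied to \<open>homogeneous m c\<close>.\<close>
definition adjoint_coeff :: "complex poly poly \<Rightarrow> nat \<Rightarrow> (nat \<Rightarrow> complex) \<Rightarrow> nat \<Rightarrow> nat \<Rightarrow> complex" where
  "adjoint_coeff p m c i j =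
     (\<Sum>(k, l)\<in>{(k, l) \<in> monomial_support p. i + j + 2 * k + l = m}. cnj (coeff2 p k l) * c (i + k))"

text \<open>For a fixed monomial \<open>(k, l)\<close>, the index \<open>(a, m - a)\<close> is matched with
\<open>(a - k, m - a - k - l)\<close>; indices with a negative entry contribute nothing because the
corresponding Laurent coefficients vanish.\<close>
lemma hardy_inner_homogeneous_eval2_mult:
  assumes g: "g \<in> hardy_space"
  shows "hardy_inner (homogeneous m c) (eval2 p * g)
     = (\<Sum>(i, j)\<in>{..m} \<times> {..m}. adjoint_coeff p m c i j * cnj (laurent_coeff g (int i) (int j)))"
proof -
  let ?S = "monomial_support p" and ?L = "laurent_coeff g"
  have shift: "(\<Sum>a\<le>m. c a * cnj (coeff2 p k l * ?L (int a - int k) (int (m - a) - int k - int l)))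
     = (\<Sum>(i, j)\<in>{..m} \<times> {..m}. (if i + j + 2 * k + l = m then cnj (coeff2 p k l) * c (i + k) else 0) * cnj (?L (int i) (int j)))"
    for k l
  proof (rule sum.reindex_bij_witness_not_neutral[where
      S' = "{a \<in> {..m}. a < k \<or> m - a < k + l}" and
      T' = "{x \<in> {..m} \<times> {..m}. fst x + snd x + 2 * k + l \<noteq> m}" and
      i = "\<lambda>(i, j). i + k" and j = "\<lambda>a. (a - k, m - a - k - l)"])
    have vanish: "c a * cnj (coeff2 p k l * ?L (int a - int k) (int (m - a) - int k - int l)) = 0"
      if "a < k \<or> m - a < k + l" for a
      using laurent_coeff_eq_0_left[OF hardy_space_holomorphic[OF g]] laurent_coeff_eq_0_right[OF g] that by auto
    show "c a * cnj (coeff2 p k l * ?L (int a - int k) (int (m - a) - int k - int l)) = 0"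
      if "a \<in> {a \<in> {..m}. a < k \<or> m - a < k + l}" for a
      by (rule vanish) (use that in simp)
    show "(case (a - k, m - a - k - l) of (i, j) \<Rightarrow>
        (if i + j + 2 * k + l = m then cnj (coeff2 p k l) * c (i + k) else 0) * cnj (?L (int i) (int j)))
      = c a * cnj (coeff2 p k l * ?L (int a - int k) (int (m - a) - int k - int l))" if "a \<in> {..m}" for a
    proof (cases "a < k \<or> m - a < k + l")
      case True
      then have "a - k + (m - a - k - l) + 2 * k + l \<noteq> m" using that by auto
      then show ?thesis unfolding vanish[OF True] by simp
    next
      case False
      then have "a - k + (m - a - k - l) + 2 * k + l = m" using that by auto
      then show ?thesis using False that by (simp add: of_nat_diff algebra_simps)
    qed
  qed auto
  have "hardy_inner (homogeneous m c) (eval2 p * g)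
     = (\<Sum>a\<le>m. c a * cnj (\<Sum>(k, l)\<in>?S. coeff2 p k l * ?L (int a - int k) (int (m - a) - int k - int l)))"
    unfolding hardy_inner_homogeneous[OF eval2_mult_in_hardy_space[OF g]] laurent_coeff_eval2_mult[OF g] ..
  also have "\<dots> = (\<Sum>(k, l)\<in>?S. \<Sum>a\<le>m. c a * cnj (coeff2 p k l * ?L (int a - int k) (int (m - a) - int k - int l)))"
    unfolding cnj_sum sum_distrib_left case_prod_unfold by (rule sum.swap)
  also have "\<dots> = (\<Sum>(i, j)\<in>{..m} \<times> {..m}. \<Sum>(k, l)\<in>?S.
      (if i + j + 2 * k + l = m then cnj (coeff2 p k l) * c (i + k) else 0) * cnj (?L (int i) (int j)))"
    unfolding shift case_prod_unfold by (rule sum.swap)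
  also have "\<dots> = (\<Sum>(i, j)\<in>{..m} \<times> {..m}. adjoint_coeff p m c i j * cnj (?L (int i) (int j)))"
    unfolding adjoint_coeff_def case_prod_unfold sum_distrib_right[symmetric]
    by (subst sum.inter_filter[OF finite_monomial_support, symmetric]) simp
  finally show ?thesis .
qed

text \<open>Basis functions \<open>g = hardy_basis i j\<close> isolate one coefficient each, and conversely the inner product with
any \<open>p * g\<close> is a finite combination of these coefficients, so no density argument is involved.\<close>
lemma homogeneous_in_Q_space_iff:
  "homogeneous m c \<in> Q_space p \<longleftrightarrow> (\<forall>i j. adjoint_coeff p m c i j = 0)"
proof
  assume Q: "homogeneous m c \<in> Q_space p"
  show "\<forall>i j. adjoint_coeff p m c i j = 0"
  proof (intro allI)
    fix i j
    show "adjoint_coeff p m c i j = 0"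
    proof (cases "i + j \<le> m")
      case False
      then have "{(k, l) \<in> monomial_support p. i + j + 2 * k + l = m} = {}" by auto
      then show ?thesis by (simp only: adjoint_coeff_def sum.empty)
    next
      case True
      have "0 = hardy_inner (homogeneous m c) (eval2 p * hardy_basis i j)"
        using Q hardy_basis_in_hardy_space[of i j] by (auto simp: Q_space_def)
      also have "\<dots> = (\<Sum>x\<in>{..m} \<times> {..m}. if x = (i, j) then adjoint_coeff p m c i j else 0)"
        unfolding hardy_inner_homogeneous_eval2_mult[OF hardy_basis_in_hardy_space] laurent_coeff_hardy_basis
        by (rule sum.cong) (auto split: if_splits)
      also have "\<dots> = adjoint_coeff p m c i j" using True by simp
      finally show ?thesis by simp
    qed
  qed
next
  assume "\<forall>i j. adjoint_coeff p m c i j = 0"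
  then show "homogeneous m c \<in> Q_space p"
    by (auto simp: Q_space_def homogeneous_in_hardy_space hardy_inner_homogeneous_eval2_mult
        simp del: times_fun_apply)
qed

section \<open>Dimension counts\<close>

text \<open>The equation at \<open>x\<close> determines \<open>c x\<close> from the earlier entries, so a solution is given freely by its
values at the indices outside \<open>P\<close>. The solutions that are \<open>1\<close> at one of these free indices and
\<open>0\<close> at the others form a basis.\<close>
lemma dim_triangular_system:
  fixes L :: "nat \<Rightarrow> nat \<Rightarrow> complex"
  assumes P: "P \<subseteq> {..m}" and pivot: "\<And>x. x \<in> P \<Longrightarrow> L x x \<noteq> 0"
  shows "cfun.dim {homogeneous m c | c. \<forall>x\<in>P. (\<Sum>y\<le>x. L x y * c y) = 0} = m + 1 - card P"
proof -
  define sol where "sol c \<longleftrightarrow> (\<forall>x\<in>P. (\<Sum>y\<le>x. L x y * c y) = 0)" for c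
  have sol_iff: "sol c \<longleftrightarrow> (\<forall>x\<in>P. c x = - (\<Sum>y<x. L x y * c y) / L x x)" for c
    unfolding sol_def using pivot
    by (intro ball_cong refl) (auto simp: lessThan_Suc_atMost[symmetric] field_simps eq_neg_iff_add_eq_0)
  have extend: "\<exists>c. sol c \<and> (\<forall>x. x \<notin> P \<longrightarrow> c x = g x)" for g
  proof -
    have "\<exists>c. (\<forall>x\<in>P. x < N \<longrightarrow> c x = - (\<Sum>y<x. L x y * c y) / L x x) \<and> (\<forall>x. x \<notin> P \<longrightarrow> c x = g x)" for N
    proof (induction N)
      case (Suc N)
      then obtain c where c: "\<forall>x\<in>P. x < N \<longrightarrow> c x = - (\<Sum>y<x. L x y * c y) / L x x" "\<forall>x. x \<notin> P \<longrightarrow> c x = g x"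
        by blast
      let ?c = "if N \<in> P then c(N := - (\<Sum>y<N. L N y * c y) / L N N) else c"
      have same: "(\<Sum>y<x. L x y * ?c y) = (\<Sum>y<x. L x y * c y)" if "x \<le> N" for x
        using that by (intro sum.cong) auto
      have "\<forall>x\<in>P. x < Suc N \<longrightarrow> ?c x = - (\<Sum>y<x. L x y * ?c y) / L x x"
      proof (intro ballI impI)
        fix x assume x: "x \<in> P" "x < Suc N"
        then have "?c x = - (\<Sum>y<x. L x y * c y) / L x x" using c(1) by (cases "x = N") auto
        then show "?c x = - (\<Sum>y<x. L x y * ?c y) / L x x" using same[of x] x(2) by simp
      qed
      moreover have "\<forall>x. x \<notin> P \<longrightarrow> ?c x = g x" using c(2) by auto
      ultimately show ?case by blast
    qed auto
    from this[of "Suc m"] show ?thesis using P unfolding sol_iff by (auto simp: less_Suc_eq_le)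
  qed
  have "\<forall>a. \<exists>c. sol c \<and> (\<forall>x. x \<notin> P \<longrightarrow> c x = (if x = a then 1 else 0))"
    by (rule allI, rule extend)
  from choice[OF this] obtain C
    where "\<forall>a. sol (C a) \<and> (\<forall>x. x \<notin> P \<longrightarrow> C a x = (if x = a then 1 else 0))" by blast
  then have C: "\<And>a. sol (C a)" "\<And>a x. x \<notin> P \<Longrightarrow> C a x = (if x = a then 1 else 0)" by auto
  define free where "free = {..m} - P"
  have fin: "finite free" by (simp add: free_def)
  have determined: "c x = d x" if "sol c" "sol d" "\<And>x. x \<in> free \<Longrightarrow> c x = d x" "x \<le> m" for c d x
    using that(4)
  proof (induction x rule: less_induct)
    case (less x)
    show ?case
    proof (cases "x \<in> P")
      case True
      have "(\<Sum>y<x. L x y * c y) = (\<Sum>y<x. L x y * d y)"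
        using less by (intro sum.cong) auto
      then show ?thesis using that(1,2) True unfolding sol_iff by simp
    next
      case False
      then show ?thesis using that(3) less.prems by (simp add: free_def)
    qed
  qed
  define e where "e a = homogeneous m (C a)" for a
  have coord: "homogeneous m (\<lambda>x. \<Sum>a\<in>free. k a * C a x) = (\<Sum>a\<in>free. fscale (k a) (e a))" for k
    by (simp add: homogeneous_sum e_def)
  have free_val: "(\<Sum>a\<in>free. k a * C a x) = k x" if "x \<in> free" for k x
  proof -
    have "(\<Sum>a\<in>free. k a * C a x) = (\<Sum>a\<in>free. if a = x then k a else 0)"
      using that C(2) by (intro sum.cong) (auto simp: free_def)
    then show ?thesis using that fin by simp
  qed
  have inj: "inj_on e free"
  proof (rule inj_onI)
    fix a b assume ab: "a \<in> free" "b \<in> free" "e a = e b"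
    then have "C a a = C b a" unfolding e_def by (intro homogeneous_eqD) (auto simp: free_def)
    then show "a = b" using ab C(2)[of a] by (auto simp: free_def split: if_splits)
  qed
  have "cfun.independent (e ` free)"
  proof
    assume "cfun.dependent (e ` free)"
    then obtain u v where u: "v \<in> e ` free" "u v \<noteq> 0" "(\<Sum>v\<in>e ` free. fscale (u v) v) = 0"
      using cfun.dependent_finite[of "e ` free"] fin by auto
    then have "(\<Sum>a\<in>free. fscale (u (e a)) (e a)) = 0"
      using sum.reindex[OF inj, of "\<lambda>v. fscale (u v) v"] by (simp add: o_def)
    then have z: "homogeneous m (\<lambda>x. \<Sum>a\<in>free. u (e a) * C a x) = homogeneous m (\<lambda>x. 0)"
      by (simp add: coord homogeneous_zero)
    obtain a where a: "a \<in> free" "v = e a" using u(1) by auto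
    have "(\<Sum>b\<in>free. u (e b) * C b a) = 0"
      using homogeneous_eqD[OF z, of a] a(1) by (auto simp: free_def)
    then show False using free_val[OF a(1), of "\<lambda>a. u (e a)"] u(2) a(2) by simp
  qed
  moreover have "e ` free \<subseteq> {homogeneous m c | c. sol c}"
    using C(1) by (auto simp: e_def)
  moreover have "{homogeneous m c | c. sol c} \<subseteq> cfun.span (e ` free)"
  proof
    fix f assume "f \<in> {homogeneous m c | c. sol c}"
    then obtain c where c: "f = homogeneous m c" "sol c" by auto
    have "sol (\<lambda>x. \<Sum>a\<in>free. c a * C a x)"
      unfolding sol_def
    proof
      fix x assume x: "x \<in> P"
      have "(\<Sum>y\<le>x. L x y * (\<Sum>a\<in>free. c a * C a y)) = (\<Sum>a\<in>free. c a * (\<Sum>y\<le>x. L x y * C a y))"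
        unfolding sum_distrib_left by (subst sum.swap) (simp add: mult_ac)
      then show "(\<Sum>y\<le>x. L x y * (\<Sum>a\<in>free. c a * C a y)) = 0"
        using C(1) x by (simp add: sol_def)
    qed
    from determined[OF c(2) this] have "f = homogeneous m (\<lambda>x. \<Sum>a\<in>free. c a * C a x)"
      unfolding c(1) by (intro homogeneous_cong) (simp add: free_val)
    also have "\<dots> \<in> cfun.span (e ` free)"
      unfolding coord by (intro cfun.span_sum cfun.span_scale cfun.span_base imageI)
    finally show "f \<in> cfun.span (e ` free)" .
  qed
  moreover have "card (e ` free) = m + 1 - card P"
    using card_image[OF inj] card_Diff_subset[of P "{..m}"] P finite_subset[OF P] by (simp add: free_def)
  ultimately have "cfun.dim {homogeneous m c | c. sol c} = m + 1 - card P"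
    by (intro cfun.dim_unique[of "e ` free"])
  then show ?thesis unfolding sol_def .
qed

lemma Q_space_Int_F_space:
  "Q_space p \<inter> F_space m = {homogeneous m c | c. \<forall>i j. adjoint_coeff p m c i j = 0}"
  unfolding F_space_eq_homogeneous using homogeneous_in_Q_space_iff by auto

text \<open>Only \<open>i + j = m - d\<close> gives a condition, and the equation for \<open>i\<close> involves the indices \<open>i + k\<close>.
The monomials have distinct exponents \<open>k\<close>, so the largest one, \<open>K\<close>, is a pivot at
\<open>x = i + K\<close>; there are \<open>m - d + 1\<close> such \<open>x\<close> when \<open>d \<le> m\<close>.\<close>
lemma dim_Q_space_same_degree:
  assumes ne: "monomial_support p \<noteq> {}"
    and deg: "\<And>k l. (k, l) \<in> monomial_support p \<Longrightarrow> 2 * k + l = d"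
  shows "cfun.dim (Q_space p \<inter> F_space m) = min (m + 1) d"
proof -
  let ?S = "monomial_support p"
  have adj: "adjoint_coeff p m c i j = (if i + j + d = m then \<Sum>(k, l)\<in>?S. cnj (coeff2 p k l) * c (i + k) else 0)" for c i j
  proof -
    have "i + j + 2 * k + l = m \<longleftrightarrow> i + j + d = m" if "(k, l) \<in> ?S" for k l
      using deg[OF that] by auto
    then have "{(k, l) \<in> ?S. i + j + 2 * k + l = m} = (if i + j + d = m then ?S else {})"
      by auto
    then show ?thesis by (simp add: adjoint_coeff_def)
  qed
  show ?thesis
  proof (cases "m < d")
    case True
    then have "Q_space p \<inter> F_space m = {homogeneous m c | c. \<forall>x\<in>{}. (\<Sum>y\<le>x. 1 * c y) = 0}"
      by (auto simp: Q_space_Int_F_space adj)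
    then show ?thesis using dim_triangular_system[of "{}" m "\<lambda>_ _. 1"] True by simp
  next
    case False
    then have md: "d \<le> m" by simp
    define K where "K = Max (fst ` ?S)"
    have fin: "finite ?S" by (rule finite_monomial_support)
    have "K \<in> fst ` ?S" unfolding K_def using ne fin by (intro Max_in) auto
    then obtain l0 where l0: "(K, l0) \<in> ?S" by auto
    have K: "k \<le> K" if "(k, l) \<in> ?S" for k l
      unfolding K_def using that fin by (intro Max_ge) (auto intro: rev_image_eqI)
    have Kd: "2 * K + l0 = d" using deg[OF l0] .
    define L where "L x y = (\<Sum>(k, l)\<in>?S. if y + K = x + k then cnj (coeff2 p k l) else 0)" for x y
    have pivot: "L x x \<noteq> 0" for x
    proof -
      have "L x x = (\<Sum>s\<in>?S. if s = (K, l0) then cnj (coeff2 p K l0) else 0)"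
        unfolding L_def
      proof (rule sum.cong)
        fix s assume s: "s \<in> ?S"
        obtain k l where kl: "s = (k, l)" by (cases s)
        show "(case s of (k, l) \<Rightarrow> if x + K = x + k then cnj (coeff2 p k l) else 0) = (if s = (K, l0) then cnj (coeff2 p K l0) else 0)"
          using deg[of k l] s kl Kd by auto
      qed simp
      then show ?thesis using l0 fin by (simp add: monomial_support_def)
    qed
    have row: "(\<Sum>y\<le>i + K. L (i + K) y * c y) = (\<Sum>(k, l)\<in>?S. cnj (coeff2 p k l) * c (i + k))" for i c
    proof -
      have "(\<Sum>y\<le>i + K. L (i + K) y * c y)
          = (\<Sum>(k, l)\<in>?S. \<Sum>y\<le>i + K. (if y = i + k then cnj (coeff2 p k l) * c (i + k) else 0))"
        unfolding L_def sum_distrib_right case_prod_unfold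
        by (subst sum.swap) (auto intro!: sum.cong)
      also have "\<dots> = (\<Sum>(k, l)\<in>?S. cnj (coeff2 p k l) * c (i + k))"
        using K by (intro sum.cong) auto
      finally show ?thesis .
    qed
    have "(\<forall>i j. adjoint_coeff p m c i j = 0) \<longleftrightarrow> (\<forall>x\<in>{K..K + (m - d)}. (\<Sum>y\<le>x. L x y * c y) = 0)" for c
    proof -
      have "(\<forall>i j. adjoint_coeff p m c i j = 0) \<longleftrightarrow> (\<forall>i\<le>m - d. (\<Sum>(k, l)\<in>?S. cnj (coeff2 p k l) * c (i + k)) = 0)"
      proof (intro iffI allI impI)
        fix i assume "\<forall>i j. adjoint_coeff p m c i j = 0" "i \<le> m - d"
        then have "adjoint_coeff p m c i (m - d - i) = 0" "i + (m - d - i) + d = m" using md by auto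
        then show "(\<Sum>(k, l)\<in>?S. cnj (coeff2 p k l) * c (i + k)) = 0" unfolding adj by simp
      qed (auto simp: adj)
      also have "\<dots> \<longleftrightarrow> (\<forall>i\<le>m - d. (\<Sum>y\<le>i + K. L (i + K) y * c y) = 0)" by (simp only: row)
      also have "\<dots> \<longleftrightarrow> (\<forall>x\<in>{K..K + (m - d)}. (\<Sum>y\<le>x. L x y * c y) = 0)"
      proof (intro iffI ballI allI impI)
        fix x assume *: "\<forall>i\<le>m - d. (\<Sum>y\<le>i + K. L (i + K) y * c y) = 0" and x: "x \<in> {K..K + (m - d)}"
        then show "(\<Sum>y\<le>x. L x y * c y) = 0" using *[rule_format, of "x - K"] by auto
      qed auto
      finally show ?thesis .
    qed
    then have "Q_space p \<inter> F_space m = {homogeneous m c | c. \<forall>x\<in>{K..K + (m - d)}. (\<Sum>y\<le>x. L x y * c y) = 0}"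
      unfolding Q_space_Int_F_space by simp
    moreover have "{K..K + (m - d)} \<subseteq> {..m}" using Kd md by auto
    ultimately show ?thesis
      using dim_triangular_system[of "{K..K + (m - d)}" m L] pivot md by simp
  qed
qed

text \<open>Given \<open>i\<close> and \<open>j\<close> at most one monomial satisfies \<open>i + j + 2 k + l = m\<close>, so every equation just says
that one coefficient is zero.\<close>
lemma dim_Q_space_distinct_degrees:
  assumes distinct: "inj_on (\<lambda>(k, l). 2 * k + l) (monomial_support p)"
  shows "cfun.dim (Q_space p \<inter> F_space m)
    = m + 1 - card {a. a \<le> m \<and> (\<exists>(k, l)\<in>monomial_support p. k \<le> a \<and> k + l \<le> m - a)}"
proof -
  let ?S = "monomial_support p"
  define P where "P = {a. a \<le> m \<and> (\<exists>(k, l)\<in>?S. k \<le> a \<and> k + l \<le> m - a)}"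
  have "(\<forall>i j. adjoint_coeff p m c i j = 0) \<longleftrightarrow> (\<forall>x\<in>P. c x = 0)" for c
  proof (intro iffI allI ballI)
    fix x assume *: "\<forall>i j. adjoint_coeff p m c i j = 0" and "x \<in> P"
    then obtain k l where kl: "(k, l) \<in> ?S" "x \<le> m" "k \<le> x" "k + l \<le> m - x" by (auto simp: P_def)
    let ?i = "x - k" and ?j = "m - x - k - l"
    have "{(k', l') \<in> ?S. ?i + ?j + 2 * k' + l' = m} = {(k, l)}"
    proof (intro equalityI subsetI)
      fix s assume "s \<in> {(k', l') \<in> ?S. ?i + ?j + 2 * k' + l' = m}"
      then obtain k' l' where s: "s = (k', l')" "(k', l') \<in> ?S" "2 * k' + l' = 2 * k + l"
        using kl by auto
      then show "s \<in> {(k, l)}" using inj_onD[OF distinct, of "(k', l')" "(k, l)"] kl(1) by simp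
    qed (use kl in auto)
    then have "adjoint_coeff p m c ?i ?j = cnj (coeff2 p k l) * c (?i + k)"
      by (simp add: adjoint_coeff_def)
    then show "c x = 0" using * kl by (auto simp: monomial_support_def)
  next
    fix i j assume *: "\<forall>x\<in>P. c x = 0"
    show "adjoint_coeff p m c i j = 0"
      unfolding adjoint_coeff_def
    proof (rule sum.neutral, clarify)
      fix k l assume "(k, l) \<in> ?S" "m = i + j + 2 * k + l"
      then have "i + k \<in> P" by (auto simp: P_def intro!: bexI[of _ "(k, l)"])
      then show "cnj (coeff2 p k l) * c (i + k) = 0" using * by simp
    qed
  qed
  moreover have "(\<Sum>y\<le>x. (if y = x then 1 else 0) * c y) = c x" for x :: nat and c :: "nat \<Rightarrow> complex"
    by (simp add: if_distrib[where f = "\<lambda>v. v * _"] cong: if_cong)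
  ultimately have "Q_space p \<inter> F_space m
      = {homogeneous m c | c. \<forall>x\<in>P. (\<Sum>y\<le>x. (if y = x then 1 else 0) * c y) = 0}"
    unfolding Q_space_Int_F_space by simp
  then show ?thesis
    using dim_triangular_system[of P m "\<lambda>x y. if y = x then 1 else 0"] by (auto simp: P_def)
qed

text \<open>The union of the quadrants with corners \<open>(k, k + l)\<close> meets a remote antidiagonal in the same points
as the single quadrant with corner \<open>(K, L)\<close>: to the right of the corner attaining \<open>L\<close>, the condition
for that corner reduces to the one on \<open>L\<close>; to its left, the second entry is so large that only the
condition of the corner attaining \<open>K\<close> on the first entry matters.\<close>
lemma staircase_complement_eventually:
  fixes S :: "(nat \<times> nat) set"
  assumes S: "finite S" "S \<noteq> {}"
  defines "K \<equiv> Min (fst ` S)" and "L \<equiv> Min ((\<lambda>(k, l). k + l) ` S)"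
  shows "\<exists>m0. \<forall>m\<ge>m0. m + 1 - card {a. a \<le> m \<and> (\<exists>(k, l)\<in>S. k \<le> a \<and> k + l \<le> m - a)} = L + K"
proof -
  have "K \<in> fst ` S" "L \<in> (\<lambda>(k, l). k + l) ` S"
    unfolding K_def L_def using S by (intro Min_in; simp)+
  then obtain l0 k1 l1 where att: "(K, l0) \<in> S" "(k1, l1) \<in> S" "L = k1 + l1" by auto
  have K: "K \<le> k" and L: "L \<le> k + l" if "(k, l) \<in> S" for k l
    unfolding K_def L_def using that S by (auto intro!: Min_le intro: rev_image_eqI)
  \<comment> \<open>If \<open>a < k1\<close>, this bound gives \<open>m - a \<ge> K + l0\<close>, as the corner attaining \<open>K\<close> requires.\<close>
  show ?thesis
  proof (intro exI[of _ "k1 + K + l0"] allI impI)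
    fix m assume m: "k1 + K + l0 \<le> m"
    have "{a. a \<le> m \<and> (\<exists>(k, l)\<in>S. k \<le> a \<and> k + l \<le> m - a)} = {K..m - L}"
    proof (intro equalityI subsetI)
      fix a assume "a \<in> {a. a \<le> m \<and> (\<exists>(k, l)\<in>S. k \<le> a \<and> k + l \<le> m - a)}"
      then obtain k l where "(k, l) \<in> S" "k \<le> a" "k + l \<le> m - a" "a \<le> m" by auto
      with K[of k l] L[of k l] show "a \<in> {K..m - L}" by auto
    next
      fix a assume a: "a \<in> {K..m - L}"
      have "\<exists>(k, l)\<in>S. k \<le> a \<and> k + l \<le> m - a"
      proof (cases "k1 \<le> a")
        case True
        then show ?thesis using att a L[OF att(1)] m by (intro bexI[of _ "(k1, l1)"]) auto
      next
        case False
        then show ?thesis using att a m by (intro bexI[of _ "(K, l0)"]) auto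
      qed
      then show "a \<in> {a. a \<le> m \<and> (\<exists>(k, l)\<in>S. k \<le> a \<and> k + l \<le> m - a)}" using a by auto
    qed
    then show "m + 1 - card {a. a \<le> m \<and> (\<exists>(k, l)\<in>S. k \<le> a \<and> k + l \<le> m - a)} = L + K"
      using m L[OF att(1)] K[OF att(2)] by simp
  qed
qed

theorem theorem4p3:
  "(\<forall>q n m :: nat.
      (m < 2 * q + n \<longrightarrow> cfun.dim (Q_space (monom2 1 q n) \<inter> F_space m) = m + 1) \<and>
      (m \<ge> 2 * q + n \<longrightarrow> cfun.dim (Q_space (monom2 1 q n) \<inter> F_space m) = 2 * q + n))
   \<and>
   (\<forall>p :: complex poly poly.
      p \<noteq> 0 \<and> coeff2 p 0 0 = 0 \<and>
      (\<forall>i j i' j'. coeff2 p i j \<noteq> 0 \<and> coeff2 p i' j' \<noteq> 0 \<and> (i, j) \<noteq> (i', j') \<longrightarrow>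
          hartogs_degree i j \<noteq> hartogs_degree i' j') \<longrightarrow>
      (\<exists>m0 :: nat. \<forall>m \<ge> m0. cfun.dim (Q_space p \<inter> F_space m) =
          Min {i + j | i j. coeff2 p i j \<noteq> 0} + Min {i. \<exists>j. coeff2 p i j \<noteq> 0}))
   \<and>
   (\<forall>(t :: nat) (b :: nat \<Rightarrow> complex) (q :: nat \<Rightarrow> nat) (n :: nat \<Rightarrow> nat) (p :: complex poly poly).
      (\<forall>k \<le> t. b k \<noteq> 0) \<and>
      p = (\<Sum>k\<le>t. monom2 (b k) (q k) (n k)) \<and>
      inj_on (\<lambda>k. (q k, n k)) {..t} \<and>
      (\<forall>k \<le> t. \<forall>l \<le> t. hartogs_degree (q k) (n k) = hartogs_degree (q l) (n l)) \<and>
      (\<forall>k < t. q k \<le> q (k + 1)) \<longrightarrow>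
      (\<forall>m :: nat.
         (m < 2 * q 0 + n 0 \<longrightarrow> cfun.dim (Q_space p \<inter> F_space m) = m + 1) \<and>
         (m \<ge> q t + q 0 + n 0 \<longrightarrow> cfun.dim (Q_space p \<inter> F_space m) = 2 * q 0 + n 0)))"
proof (intro conjI)
  have "cfun.dim (Q_space (monom2 1 q n) \<inter> F_space m) = min (m + 1) (2 * q + n)" for q n m
    by (rule dim_Q_space_same_degree) (auto simp: monomial_support_def coeff2_monom2 split: if_splits)
  then show "\<forall>q n m :: nat.
      (m < 2 * q + n \<longrightarrow> cfun.dim (Q_space (monom2 1 q n) \<inter> F_space m) = m + 1) \<and>
      (m \<ge> 2 * q + n \<longrightarrow> cfun.dim (Q_space (monom2 1 q n) \<inter> F_space m) = 2 * q + n)"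
    by simp
next
  show "\<forall>p :: complex poly poly.
      p \<noteq> 0 \<and> coeff2 p 0 0 = 0 \<and>
      (\<forall>i j i' j'. coeff2 p i j \<noteq> 0 \<and> coeff2 p i' j' \<noteq> 0 \<and> (i, j) \<noteq> (i', j') \<longrightarrow>
          hartogs_degree i j \<noteq> hartogs_degree i' j') \<longrightarrow>
      (\<exists>m0 :: nat. \<forall>m \<ge> m0. cfun.dim (Q_space p \<inter> F_space m) =
          Min {i + j | i j. coeff2 p i j \<noteq> 0} + Min {i. \<exists>j. coeff2 p i j \<noteq> 0})"
  proof (intro allI impI, elim conjE)
    fix p :: "complex poly poly"
    assume p: "p \<noteq> 0" and deg: "\<forall>i j i' j'. coeff2 p i j \<noteq> 0 \<and> coeff2 p i' j' \<noteq> 0 \<and> (i, j) \<noteq> (i', j') \<longrightarrow>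
          hartogs_degree i j \<noteq> hartogs_degree i' j'"
    have ne: "monomial_support p \<noteq> {}"
      using p by (auto simp: monomial_support_def coeff2_def poly_eq_iff)
    have inj: "inj_on (\<lambda>(k, l). 2 * k + l) (monomial_support p)"
    proof (rule inj_onI)
      fix x y assume xy: "x \<in> monomial_support p" "y \<in> monomial_support p"
        "(case x of (k, l) \<Rightarrow> 2 * k + l) = (case y of (k, l) \<Rightarrow> 2 * k + l)"
      have "hartogs_degree (fst x) (snd x) \<noteq> hartogs_degree (fst y) (snd y)" if "x \<noteq> y"
        using xy that by (intro deg[rule_format]) (auto simp: monomial_support_def prod_eq_iff)
      then show "x = y" using xy(3) by (auto simp: hartogs_degree_def case_prod_unfold)
    qed
    have "{i + j | i j. coeff2 p i j \<noteq> 0} = (\<lambda>(k, l). k + l) ` monomial_support p"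
      by (auto simp: monomial_support_def image_iff)
    moreover have "{i. \<exists>j. coeff2 p i j \<noteq> 0} = fst ` monomial_support p"
      by (auto simp: monomial_support_def image_iff)
    ultimately show "\<exists>m0 :: nat. \<forall>m \<ge> m0. cfun.dim (Q_space p \<inter> F_space m) =
          Min {i + j | i j. coeff2 p i j \<noteq> 0} + Min {i. \<exists>j. coeff2 p i j \<noteq> 0}"
      using staircase_complement_eventually[OF finite_monomial_support ne]
      by (simp only: dim_Q_space_distinct_degrees[OF inj])
  qed
next
  show "\<forall>(t :: nat) (b :: nat \<Rightarrow> complex) (q :: nat \<Rightarrow> nat) (n :: nat \<Rightarrow> nat) (p :: complex poly poly).
      (\<forall>k \<le> t. b k \<noteq> 0) \<and>
      p = (\<Sum>k\<le>t. monom2 (b k) (q k) (n k)) \<and>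
      inj_on (\<lambda>k. (q k, n k)) {..t} \<and>
      (\<forall>k \<le> t. \<forall>l \<le> t. hartogs_degree (q k) (n k) = hartogs_degree (q l) (n l)) \<and>
      (\<forall>k < t. q k \<le> q (k + 1)) \<longrightarrow>
      (\<forall>m :: nat.
         (m < 2 * q 0 + n 0 \<longrightarrow> cfun.dim (Q_space p \<inter> F_space m) = m + 1) \<and>
         (m \<ge> q t + q 0 + n 0 \<longrightarrow> cfun.dim (Q_space p \<inter> F_space m) = 2 * q 0 + n 0))"
  proof (intro allI impI, elim conjE)
    fix t :: nat and b :: "nat \<Rightarrow> complex" and q n :: "nat \<Rightarrow> nat" and p :: "complex poly poly" and m :: nat
    assume b: "\<forall>k \<le> t. b k \<noteq> 0" and p: "p = (\<Sum>k\<le>t. monom2 (b k) (q k) (n k))"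
      and inj: "inj_on (\<lambda>k. (q k, n k)) {..t}"
      and deg: "\<forall>k \<le> t. \<forall>l \<le> t. hartogs_degree (q k) (n k) = hartogs_degree (q l) (n l)"
      and mono: "\<forall>k < t. q k \<le> q (k + 1)"
    have coeff: "coeff2 p i j = (\<Sum>k\<le>t. if q k = i \<and> n k = j then b k else 0)" for i j
      by (simp only: coeff2_monom2[symmetric]) (simp only: p coeff2_def coeff_sum)
    have "coeff2 p (q 0) (n 0) = (\<Sum>k\<le>t. if k = 0 then b k else 0)"
      unfolding coeff using inj_onD[OF inj, of _ 0] by (intro sum.cong) auto
    then have "(q 0, n 0) \<in> monomial_support p" using b by (simp add: monomial_support_def)
    then have ne: "monomial_support p \<noteq> {}" by blast
    have "2 * k + l = 2 * q 0 + n 0" if kl: "(k, l) \<in> monomial_support p" for k l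
    proof -
      have "\<exists>i\<le>t. q i = k \<and> n i = l"
      proof (rule ccontr)
        assume "\<not> (\<exists>i\<le>t. q i = k \<and> n i = l)"
        then have "coeff2 p k l = 0" unfolding coeff by (intro sum.neutral) auto
        then show False using kl by (simp add: monomial_support_def)
      qed
      then obtain i where "i \<le> t" "q i = k" "n i = l" by blast
      then show ?thesis using deg[rule_format, of i 0] by (simp add: hartogs_degree_def)
    qed
    then have dim: "cfun.dim (Q_space p \<inter> F_space m) = min (m + 1) (2 * q 0 + n 0)"
      by (rule dim_Q_space_same_degree[OF ne])
    have "q 0 \<le> q k" if "k \<le> t" for k
      using that
    proof (induction k)
      case (Suc k)
      then show ?case using mono[rule_format, of k] by simp
    qed simp
    then have "q 0 \<le> q t" by simp
    then show "(m < 2 * q 0 + n 0 \<longrightarrow> cfun.dim (Q_space p \<inter> F_space m) = m + 1) \<and>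
         (m \<ge> q t + q 0 + n 0 \<longrightarrow> cfun.dim (Q_space p \<inter> F_space m) = 2 * q 0 + n 0)"
      unfolding dim by auto
  qed
qed

end
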